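(* Consider any family of geodesics on a non-developable surface $\mathbf S\subset\mathbb{C}P_3$, that is, the integral curves on $\mathbf S$ of an equation $$u''=A+Bu'+Cu'^2+Du'^3 ,$$ where $A,B,C,D$ are functions of $(x,u)$. The geodesics of the family which pass through a given point $P$ of $\mathbf S$ form a one-parameter family. Their osculating planes at $P$ envelop generically a cubic cone, whose equation in the local coordinates $(\chi_1,\chi_2,\chi_3,\chi_4)$ at $P$ is $$2\chi_2\chi_3\chi_4+(A+2a_1)\chi_2^3-(3B-2b_1)\chi_2^2\chi_3+(3C+2a)\chi_2\chi_3^2-(D-2b)\chi_3^3=0 ,$$ and which intersects the embedded tangent plane $\Pi_P$ of $\mathbf S$ at $P$ along its asymptotic tangents. Conversely, given any system of cubic cones associated with the given surface in this manner, one may, using the displayed equation of the cone, solve for the four functions $A,B,C,D$ of $x$ and $u$. Therefore this cubic cone may be regarded, by that equation, as corresponding to some equation of the form $u''=A+Bu'+Cu'^2+Du'^3$, or equivalently $dx\,d^2u-du\,d^2x=A\,dx^3+B\,dx^2du+C\,dx\,du^2+D\,du^3$.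
   Context: Everything is complex analytic. A surface $\mathbf S\subset\mathbb{C}P_3$ is given by homogeneous coordinates $y=y(x,u)=(y_1,\dots,y_4)$, single-valued analytic functions of $(x,u)$ on a domain, which satisfy no linear homogeneous first-order equation $\mathcal A y_x+\mathcal B y_u+\mathcal C y=0$ with scalar coefficients not all zero. Its asymptotic curves are the curves satisfying $L\,dx^2+2M\,dx\,du+N\,du^2=0$, where $L=\det(y_{xx},y,y_x,y_u)$, $M=\det(y_{xu},y,y_x,y_u)$, $N=\det(y_{uu},y,y_x,y_u)$. The surface is non-developable if $LN-M^2\neq0$. The parametric net $dx\,du=0$ is taken to be the net of asymptotic curves; then $y,y_x,y_u,y_{xu}$ are linearly independent and $$y_{xx}+cy+2ay_x+2by_u=0,\qquad y_{uu}+c_1y+2a_1y_x+2b_1y_u=0 ,$$ which defines the scalar functions $a,b,c,a_1,b_1,c_1$ of $(x,u)$. A geodesic is a curve on $\mathbf S$ with curvilinear equation $u=u(x)$, where $u(x)$ satisfies the given second-order equation ($u'=du/dx$, $u''=d^2u/dx^2$); no metric is involved. The osculating plane of a curve at the point $P=y$ is the plane spanned by $y,y',y''$ (derivatives along the curve). The embedded tangent plane $\Pi_P$ is spanned by $y,y_x,y_u$. The asymptotic tangents at $P$ are the projective lines associated with $\langle y,y_x\rangle$ and $\langle y,y_u\rangle$. Local coordinates at $P$: the point $\chi_1y+\chi_2y_x+\chi_3y_u+\chi_4y_{xu}$ has local coordinates proportional to $(\chi_1,\chi_2,\chi_3,\chi_4)$. "Generically" excludes the degenerate cases: if $D-2b$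 or $A+2a_1$ is zero, but not both, the cone is said to degenerate to a quadric cone, and it is said to degenerate to a line if and only if $D-2b=A+2a_1=0$.
   Formalization: As printed the cone equation fails: it holds in plane coordinates dual to the local ones, not for points, and for u''=A+Bu'+Cu'^2+Du'^3 its A, 3B, 3C, D must be D, C, B, A. "Generically" is accordingly D+2a_1≠0 and A-2b≠0. *)

theory Defs
  imports "HOL-Complex_Analysis.Complex_Analysis"
begin

section \<open>Analytic functions of two complex variables\<close>

text \<open>The linear map \<open>h \<mapsto> p h\<^sub>1 + q h\<^sub>2\<close> with complex \<open>p\<close>, \<open>q\<close> is the general complex linear
  one, so on an open set this is holomorphy in two variables.\<close>

definition holomorphic2_on :: "(complex \<times> complex \<Rightarrow> complex) \<Rightarrow> (complex \<times> complex) set \<Rightarrow> bool" where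
  "holomorphic2_on f W \<longleftrightarrow>
     (\<forall>z\<in>W. \<exists>p q. (f has_derivative (\<lambda>h. p * fst h + q * snd h)) (at z within W))"

definition vderiv :: "(complex \<Rightarrow> complex ^ 'n) \<Rightarrow> complex \<Rightarrow> complex ^ 'n" where
  "vderiv Y t = (\<chi> i. deriv (\<lambda>s. Y s $ i) t)"

definition Dx :: "(complex \<times> complex \<Rightarrow> complex ^ 'n) \<Rightarrow> complex \<times> complex \<Rightarrow> complex ^ 'n" where
  "Dx f z = vderiv (\<lambda>x. f (x, snd z)) (fst z)"

definition Du :: "(complex \<times> complex \<Rightarrow> complex ^ 'n) \<Rightarrow> complex \<times> complex \<Rightarrow> complex ^ 'n" where
  "Du f z = vderiv (\<lambda>u. f (fst z, u)) (snd z)"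

section \<open>Surfaces in projective 3-space\<close>

definition surface :: "(complex \<times> complex) set \<Rightarrow> (complex \<times> complex \<Rightarrow> complex ^ 4) \<Rightarrow> bool" where
  "surface W y \<longleftrightarrow>
     open W \<and> connected W \<and> W \<noteq> {} \<and> (\<forall>i. holomorphic2_on (\<lambda>z. y z $ i) W) \<and>
     \<not> (\<exists>\<A> \<B> \<C>. (\<forall>f\<in>{\<A>, \<B>, \<C>}. holomorphic2_on f W) \<and>
          (\<exists>z\<in>W. \<A> z \<noteq> 0 \<or> \<B> z \<noteq> 0 \<or> \<C> z \<noteq> 0) \<and>
          (\<forall>z\<in>W. \<A> z *s Dx y z + \<B> z *s Du y z + \<C> z *s y z = 0))"

definition form_L :: "(complex \<times> complex \<Rightarrow> complex ^ 4) \<Rightarrow> complex \<times> complex \<Rightarrow> complex" where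
  "form_L y z = det (vector [Dx (Dx y) z, y z, Dx y z, Du y z] :: complex ^ 4 ^ 4)"

definition form_M :: "(complex \<times> complex \<Rightarrow> complex ^ 4) \<Rightarrow> complex \<times> complex \<Rightarrow> complex" where
  "form_M y z = det (vector [Du (Dx y) z, y z, Dx y z, Du y z] :: complex ^ 4 ^ 4)"

definition form_N :: "(complex \<times> complex \<Rightarrow> complex ^ 4) \<Rightarrow> complex \<times> complex \<Rightarrow> complex" where
  "form_N y z = det (vector [Du (Du y) z, y z, Dx y z, Du y z] :: complex ^ 4 ^ 4)"

definition nondevelopable :: "(complex \<times> complex) set \<Rightarrow> (complex \<times> complex \<Rightarrow> complex ^ 4) \<Rightarrow> bool" where
  "nondevelopable W y \<longleftrightarrow> (\<forall>z\<in>W. form_L y z * form_N y z - (form_M y z)\<^sup>2 \<noteq> 0)"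

definition asymptotic_direction ::
    "(complex \<times> complex \<Rightarrow> complex ^ 4) \<Rightarrow> complex \<times> complex \<Rightarrow> complex \<Rightarrow> complex \<Rightarrow> bool" where
  "asymptotic_direction y z dx du \<longleftrightarrow>
     form_L y z * dx\<^sup>2 + 2 * form_M y z * dx * du + form_N y z * du\<^sup>2 = 0"

definition asymptotic_net :: "(complex \<times> complex) set \<Rightarrow> (complex \<times> complex \<Rightarrow> complex ^ 4) \<Rightarrow> bool" where
  "asymptotic_net W y \<longleftrightarrow> (\<forall>z\<in>W. \<forall>dx du. asymptotic_direction y z dx du \<longleftrightarrow> dx * du = 0)"

text \<open>Projective points, lines and planes are represented by the corresponding linear subspaces of
  \<open>\<complex>\<^sup>4\<close>; \<open>vec.span\<close> is the complex linear span.\<close>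

definition tangent_plane :: "(complex \<times> complex \<Rightarrow> complex ^ 4) \<Rightarrow> complex \<times> complex \<Rightarrow> (complex ^ 4) set" where
  "tangent_plane y z = vec.span {y z, Dx y z, Du y z}"

definition asymptotic_tangent_x :: "(complex \<times> complex \<Rightarrow> complex ^ 4) \<Rightarrow> complex \<times> complex \<Rightarrow> (complex ^ 4) set" where
  "asymptotic_tangent_x y z = vec.span {y z, Dx y z}"

definition asymptotic_tangent_u :: "(complex \<times> complex \<Rightarrow> complex ^ 4) \<Rightarrow> complex \<times> complex \<Rightarrow> (complex ^ 4) set" where
  "asymptotic_tangent_u y z = vec.span {y z, Du y z}"

definition local_point ::
    "(complex \<times> complex \<Rightarrow> complex ^ 4) \<Rightarrow> complex \<times> complex \<Rightarrow> complex ^ 4 \<Rightarrow> complex ^ 4" where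
  "local_point y z \<eta> =
     \<eta> $ 1 *s y z + \<eta> $ 2 *s Dx y z + \<eta> $ 3 *s Du y z + \<eta> $ 4 *s Du (Dx y) z"

text \<open>The plane with the (dual) local coordinates \<open>U\<close>. It passes through the point \<open>y z\<close> itself
  iff \<open>U\<^sub>1 = 0\<close>.\<close>

definition local_plane ::
    "(complex \<times> complex \<Rightarrow> complex ^ 4) \<Rightarrow> complex \<times> complex \<Rightarrow> complex ^ 4 \<Rightarrow> (complex ^ 4) set" where
  "local_plane y z U = {local_point y z \<eta> |\<eta>. scalar_product U \<eta> = 0}"

section \<open>Geodesics and osculating planes\<close>

definition geodesic ::
    "(complex \<times> complex) set \<Rightarrow> (complex \<times> complex \<Rightarrow> complex) \<Rightarrow> (complex \<times> complex \<Rightarrow> complex) \<Rightarrow>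
     (complex \<times> complex \<Rightarrow> complex) \<Rightarrow> (complex \<times> complex \<Rightarrow> complex) \<Rightarrow>
     complex set \<Rightarrow> (complex \<Rightarrow> complex) \<Rightarrow> bool" where
  "geodesic W A B C D X u \<longleftrightarrow>
     open X \<and> connected X \<and> u holomorphic_on X \<and>
     (\<forall>x\<in>X. (x, u x) \<in> W \<and>
        deriv (deriv u) x = A (x, u x) + B (x, u x) * deriv u x + C (x, u x) * (deriv u x)\<^sup>2
                            + D (x, u x) * (deriv u x) ^ 3)"

definition geodesic_through ::
    "(complex \<times> complex) set \<Rightarrow> (complex \<times> complex \<Rightarrow> complex) \<Rightarrow> (complex \<times> complex \<Rightarrow> complex) \<Rightarrow>
     (complex \<times> complex \<Rightarrow> complex) \<Rightarrow> (complex \<times> complex \<Rightarrow> complex) \<Rightarrow> complex \<times> complex \<Rightarrow>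
     complex set \<Rightarrow> (complex \<Rightarrow> complex) \<Rightarrow> bool" where
  "geodesic_through W A B C D P X u \<longleftrightarrow>
     geodesic W A B C D X u \<and> fst P \<in> X \<and> u (fst P) = snd P"

text \<open>The geodesics through \<open>P\<close>, as germs, are parametrized bijectively by the slope
  \<open>u' \<in> \<complex>\<close> at \<open>P\<close>.\<close>

definition geodesics_one_parameter ::
    "(complex \<times> complex) set \<Rightarrow> (complex \<times> complex \<Rightarrow> complex) \<Rightarrow> (complex \<times> complex \<Rightarrow> complex) \<Rightarrow>
     (complex \<times> complex \<Rightarrow> complex) \<Rightarrow> (complex \<times> complex \<Rightarrow> complex) \<Rightarrow> complex \<times> complex \<Rightarrow> bool" where
  "geodesics_one_parameter W A B C D P \<longleftrightarrow>
     (\<forall>p. \<exists>X u. geodesic_through W A B C D P X u \<and> deriv u (fst P) = p) \<and>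
     (\<forall>X u X' v. geodesic_through W A B C D P X u \<and> geodesic_through W A B C D P X' v \<and>
        deriv u (fst P) = deriv v (fst P) \<longrightarrow> (\<forall>\<^sub>F x in nhds (fst P). u x = v x))"

definition osculating_plane ::
    "(complex \<times> complex \<Rightarrow> complex ^ 4) \<Rightarrow> (complex \<Rightarrow> complex) \<Rightarrow> complex \<Rightarrow> (complex ^ 4) set" where
  "osculating_plane y u x =
     (let Y = (\<lambda>s. y (s, u s)) in vec.span {Y x, vderiv Y x, vderiv (vderiv Y) x})"

section \<open>Envelopes and cones\<close>

text \<open>Envelope of a one-parameter family of planes \<open>F p\<close>, \<open>p \<in> \<complex>\<close>: the union of the
  characteristic lines \<open>\<omega> p \<cdot> v = \<omega>' p \<cdot> v = 0\<close>, where \<open>\<omega> q \<cdot> v = 0\<close> is an equation of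
  \<open>F q\<close> depending holomorphically on \<open>q\<close> near \<open>p\<close>. The characteristic line does not depend on the
  choice of \<open>\<omega>\<close>, which is unique up to a nonvanishing holomorphic factor. The closure adds the
  limiting characteristic lines for \<open>p \<rightarrow> \<infinity>\<close>.\<close>

definition envelope :: "(complex \<Rightarrow> (complex ^ 'n) set) \<Rightarrow> (complex ^ 'n) set" where
  "envelope F = closure {v. \<exists>p \<omega> S. open S \<and> p \<in> S \<and> (\<forall>i. (\<lambda>q. \<omega> q $ i) holomorphic_on S) \<and>
     (\<forall>q\<in>S. \<omega> q \<noteq> 0 \<and> F q = {w. scalar_product (\<omega> q) w = 0}) \<and>
     scalar_product (\<omega> p) v = 0 \<and> scalar_product (vderiv \<omega> p) v = 0}"

text \<open>A cone with vertex \<open>y z\<close> is given by a homogeneous equation \<open>G U = 0\<close> in the plane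
  coordinates \<open>U = (0, U\<^sub>2, U\<^sub>3, U\<^sub>4)\<close> of its tangent planes; it is cubic (of class three) if \<open>G\<close> is
  a cubic form. The tangent plane given by a nonsingular solution \<open>U\<close> touches the cone along the line
  joining \<open>y z\<close> to the point with local coordinates \<open>grad G U\<close>; these lines fill the cone up to
  closure, i.e. the cone is the dual variety of \<open>G = 0\<close>.\<close>

definition plane_gradient :: "(complex ^ 'n \<Rightarrow> complex) \<Rightarrow> complex ^ 'n \<Rightarrow> complex ^ 'n" where
  "plane_gradient G U = (\<chi> i. deriv (\<lambda>t. G (U + t *s axis i 1)) 0)"

definition tangential_cone ::
    "(complex \<times> complex \<Rightarrow> complex ^ 4) \<Rightarrow> complex \<times> complex \<Rightarrow> (complex ^ 4 \<Rightarrow> complex) \<Rightarrow> (complex ^ 4) set" where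
  "tangential_cone y z G = closure {local_point y z (r *s axis 1 1 + s *s plane_gradient G U) |r s U.
     U $ 1 = 0 \<and> G U = 0 \<and> plane_gradient G U \<noteq> 0}"

definition osculating_planes_envelop ::
    "(complex \<times> complex) set \<Rightarrow> (complex \<times> complex \<Rightarrow> complex ^ 4) \<Rightarrow>
     (complex \<times> complex \<Rightarrow> complex) \<Rightarrow> (complex \<times> complex \<Rightarrow> complex) \<Rightarrow>
     (complex \<times> complex \<Rightarrow> complex) \<Rightarrow> (complex \<times> complex \<Rightarrow> complex) \<Rightarrow> complex \<times> complex \<Rightarrow>
     (complex ^ 4 \<Rightarrow> complex) \<Rightarrow> bool" where
  "osculating_planes_envelop W y A B C D P G \<longleftrightarrow>
     (\<exists>F. (\<forall>X u. geodesic_through W A B C D P X u \<longrightarrow>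
              osculating_plane y u (fst P) = F (deriv u (fst P))) \<and>
          envelope F = tangential_cone y P G) \<and>
     {osculating_plane y u (fst P) |X u. geodesic_through W A B C D P X u} =
       {local_plane y P U |U. U \<noteq> 0 \<and> U $ 1 = 0 \<and> G U = 0}"

text \<open>The cubic of the osculating planes of the geodesics
  \<open>u'' = \<delta> + 3 \<gamma> u' + 3 \<beta> u'\<^sup>2 + \<alpha> u'\<^sup>3\<close>. Here \<open>U\<close> are plane coordinates (see
  \<open>local_plane\<close>); in terms of points the enveloped cone is of order four.\<close>

definition cone_cubic ::
    "complex \<Rightarrow> complex \<Rightarrow> complex \<Rightarrow> complex \<Rightarrow> complex \<Rightarrow> complex \<Rightarrow> complex \<Rightarrow> complex \<Rightarrow>
     complex ^ 4 \<Rightarrow> complex" where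
  "cone_cubic a b a1 b1 \<alpha> \<beta> \<gamma> \<delta> U =
     2 * U $ 2 * U $ 3 * U $ 4 + (\<alpha> + 2 * a1) * (U $ 2) ^ 3
     - (3 * \<beta> - 2 * b1) * (U $ 2)\<^sup>2 * U $ 3 + (3 * \<gamma> + 2 * a) * U $ 2 * (U $ 3)\<^sup>2
     - (\<delta> - 2 * b) * (U $ 3) ^ 3"

text \<open>For \<open>k \<noteq> 0\<close> this is the general cubic cone in plane coordinates for which the tangent plane
  \<open>U = (0, 0, 0, 1)\<close> of the surface is a double plane (node of the cubic) that touches the cone
  along the two asymptotic tangents.\<close>

definition contact_cubic ::
    "complex \<Rightarrow> complex \<Rightarrow> complex \<Rightarrow> complex \<Rightarrow> complex \<Rightarrow> complex ^ 4 \<Rightarrow> complex" where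
  "contact_cubic k k0 k1 k2 k3 U =
     k * U $ 2 * U $ 3 * U $ 4 + k0 * (U $ 2) ^ 3 + k1 * (U $ 2)\<^sup>2 * U $ 3
     + k2 * U $ 2 * (U $ 3)\<^sup>2 + k3 * (U $ 3) ^ 3"

end

theory Submission
  imports Defs
begin

text \<open>The osculating plane of the geodesic of slope \<open>p\<close> has plane coordinates
  \<open>(0, - 2 p\<^sup>2, 2 p, - K(p))\<close>, where \<open>K\<close> is the cubic polynomial with coefficients \<open>A - 2 b\<close>,
  \<open>B + 2 a\<close>, \<open>C - 2 b\<^sub>1\<close>, \<open>D + 2 a\<^sub>1\<close>; eliminating \<open>p\<close> gives the cubic of the theorem, with a node at
  \<open>p = 0\<close> and \<open>p = \<infinity>\<close>, where the osculating plane is the tangent plane of the surface and the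
  characteristic lines tend to the two asymptotic tangents. The four coefficients of \<open>K\<close> are free,
  which gives the converse. That the planes form a family over all of \<open>p \<in> \<complex>\<close> rests on the existence
  of geodesics with any given slope, by Picard iteration on discs.\<close>

text \<open>The displayed equation is read in plane coordinates, and duality carries the argument:
  the cubic vanishes along the curve \<omega>(p) of osculating planes, so its gradient there
  annihilates \<omega>'(p) and, by Euler's identity, \<omega>(p); it therefore points along the
  characteristic line. The polynomial K arises as a minor: in the local frame y' and y'' along a
  geodesic of slope p have last three coordinates (1, p, 0) and (t2, t3, 2p), and K(p) = t3 - p t2.
  The condition A - 2b \<noteq> 0 keeps the osculating plane well defined at p = 0; together with D
  + 2 a1 \<noteq> 0 it confines the solutions of the cubic to the curve \<omega> and keeps both
  limiting lines. Much of the length goes into regularity: \<open>holomorphic2_on\<close> supplies a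
  first total derivative, whereas second derivatives of y, their symmetry and the holomorphy of a,
  b, a1, b1 are called for. The first two come from Cauchy's inequality and Weierstrass' theorem,
  the last from Cramer's rule.\<close>

no_notation fps_nth (infixl "$" 75)

section \<open>Holomorphic functions of two variables\<close>

definition pdx :: "(complex \<times> complex \<Rightarrow> complex) \<Rightarrow> complex \<times> complex \<Rightarrow> complex" where
  "pdx f z = deriv (\<lambda>x. f (x, snd z)) (fst z)"

definition pdu :: "(complex \<times> complex \<Rightarrow> complex) \<Rightarrow> complex \<times> complex \<Rightarrow> complex" where
  "pdu f z = deriv (\<lambda>u. f (fst z, u)) (snd z)"

text \<open>The hypotheses of Osgood's lemma. This form passes to partial derivatives by
  one-variable arguments; \<open>holomorphic2_iff_sep\<close> returns to the total derivative that
  the chain rule requires.\<close>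

definition sep_holomorphic :: "(complex \<times> complex \<Rightarrow> complex) \<Rightarrow> (complex \<times> complex) set \<Rightarrow> bool" where
  "sep_holomorphic f W \<longleftrightarrow> continuous_on W f \<and>
     (\<forall>z\<in>W. (\<lambda>x. f (x, snd z)) field_differentiable at (fst z) \<and>
             (\<lambda>u. f (fst z, u)) field_differentiable at (snd z))"

lemma sep_holomorphicD:
  assumes "sep_holomorphic f W"
  shows "continuous_on W f"
    and "(x, u) \<in> W \<Longrightarrow> (\<lambda>x. f (x, u)) field_differentiable at x"
    and "(x, u) \<in> W \<Longrightarrow> (\<lambda>u. f (x, u)) field_differentiable at u"
    and "(x, u) \<in> W \<Longrightarrow> ((\<lambda>x. f (x, u)) has_field_derivative pdx f (x, u)) (at x)"
    and "(x, u) \<in> W \<Longrightarrow> ((\<lambda>u. f (x, u)) has_field_derivative pdu f (x, u)) (at u)"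
  using assms by (force simp: sep_holomorphic_def pdx_def pdu_def DERIV_deriv_iff_field_differentiable)+

text \<open>Interchanging the two variables lets results on \<open>pdu\<close> be read off from
  those on \<open>pdx\<close>.\<close>

lemma sep_holomorphic_swap:
  assumes "sep_holomorphic f W"
  shows "sep_holomorphic (f \<circ> prod.swap) (prod.swap -` W)"
proof -
  have "continuous_on (prod.swap -` W) (f \<circ> prod.swap)"
    by (rule continuous_on_compose)
      (auto intro!: continuous_on_swap continuous_on_subset[OF sep_holomorphicD(1)[OF assms]])
  then show ?thesis
    using assms by (auto simp: sep_holomorphic_def)
qed

lemma pdu_conv_swap: "pdu f = pdx (f \<circ> prod.swap) \<circ> prod.swap"
  by (auto simp: pdx_def pdu_def)

lemma open_swap: "open W \<Longrightarrow> open (prod.swap -` W :: ('a::topological_space \<times> 'b::topological_space) set)"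
  by (rule open_vimage) (auto intro: continuous_on_swap)

lemma open_polydisc:
  fixes x u :: complex
  assumes "open W" "(x, u) \<in> W"
  obtains r where "r > 0" "cball x r \<times> cball u r \<subseteq> W"
proof -
  obtain A B where AB: "open A" "open B" "(x, u) \<in> A \<times> B" "A \<times> B \<subseteq> W"
    using open_prod_elim[OF assms] by blast
  obtain r where r: "r > 0" "cball x r \<subseteq> A"
    using AB open_contains_cball by (metis mem_Sigma_iff)
  obtain s where s: "s > 0" "cball u s \<subseteq> B"
    using AB open_contains_cball by (metis mem_Sigma_iff)
  show thesis
  proof (rule that[of "min r s"])
    show "cball x (min r s) \<times> cball u (min r s) \<subseteq> W"
      using r s AB(4) by fastforce
  qed (use r s in auto)
qed

text \<open>Two comparisons: from (x, u) to (x, u0) by Cauchy's inequality for the difference of two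
  slices of \<open>f\<close>, which is uniformly small, and from (x, u0) to (x0, u0) by continuity
  of the derivative of a single slice.\<close>

lemma continuous_on_pdx:
  assumes W: "open W" and cont: "continuous_on W f"
    and fd: "\<And>x u. (x, u) \<in> W \<Longrightarrow> (\<lambda>x. f (x, u)) field_differentiable at x"
  shows "continuous_on W (pdx f)"
proof (rule continuous_at_imp_continuous_on, clarify)
  fix x0 u0 assume z: "(x0, u0) \<in> W"
  obtain r' where r': "r' > 0" "cball x0 r' \<times> cball u0 r' \<subseteq> W"
    using open_polydisc[OF W z] .
  \<comment> \<open>Halving the radius leaves room for a disc of radius \<open>r\<close> around
    every \<open>x\<close> near \<open>x0\<close>, on which Cauchy's inequality is applied.\<close>
  define r where "r = r' / 2"
  have r: "r > 0" "cball x0 (2 * r) \<times> cball u0 r \<subseteq> W"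
    using r' by (auto simp: r_def)
  let ?K = "cball x0 (2 * r) \<times> cball u0 r"
  have uc: "uniformly_continuous_on ?K f"
    by (rule compact_uniformly_continuous)
      (use r cont in \<open>auto intro: continuous_on_subset compact_Times\<close>)
  have hol: "(\<lambda>x. f (x, u)) holomorphic_on cball x0 (2 * r)" if "u \<in> cball u0 r" for u
    by (rule holomorphic_onI, rule field_differentiable_at_within, rule fd) (use r that in auto)
  have "(\<lambda>x. f (x, u0)) holomorphic_on ball x0 (2 * r)"
    using hol[of u0] r by (auto intro: holomorphic_on_subset)
  then have "(deriv (\<lambda>x. f (x, u0))) holomorphic_on ball x0 (2 * r)"
    by (simp add: holomorphic_deriv)
  then have dc: "isCont (deriv (\<lambda>x. f (x, u0))) x0"
    using r by (metis centre_in_ball continuous_on_eq_continuous_at holomorphic_on_imp_continuous_on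
        mult_pos_pos open_ball zero_less_numeral)
  show "isCont (pdx f) (x0, u0)"
    unfolding continuous_at_eps_delta
  proof (intro allI impI)
    fix e :: real assume e: "e > 0"
    \<comment> \<open>Cauchy's inequality divides by the radius, so a bound \<open>e / 2 * r\<close>
      on the slices yields \<open>e / 2\<close> on the derivatives.\<close>
    obtain d1 where d1: "d1 > 0" "\<And>z z'. z \<in> ?K \<Longrightarrow> z' \<in> ?K \<Longrightarrow> dist z' z < d1 \<Longrightarrow> dist (f z') (f z) < e / 2 * r"
      using uc e r unfolding uniformly_continuous_on_def by (metis half_gt_zero mult_pos_pos)
    obtain d2 where d2: "d2 > 0"
      "\<And>x. dist x x0 < d2 \<Longrightarrow> dist (deriv (\<lambda>x. f (x, u0)) x) (deriv (\<lambda>x. f (x, u0)) x0) < e / 2"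
      using dc e unfolding continuous_at_eps_delta by (metis half_gt_zero)
    show "\<exists>d>0. \<forall>z. dist z (x0, u0) < d \<longrightarrow> dist (pdx f z) (pdx f (x0, u0)) < e"
    proof (intro exI[of _ "min r (min d1 d2)"] conjI allI impI)
      fix z assume zd: "dist z (x0, u0) < min r (min d1 d2)"
      obtain x u where zx: "z = (x, u)" by (cases z)
      have dx: "dist x x0 < min r (min d1 d2)" and du: "dist u u0 < min r (min d1 d2)"
        using zd dist_fst_le[of z "(x0, u0)"] dist_snd_le[of z "(x0, u0)"] by (auto simp: zx)
      have uu: "u \<in> cball u0 r" "u0 \<in> cball u0 r"
        using du r by (auto simp: dist_commute)
      have sub: "cball x r \<subseteq> cball x0 (2 * r)"
        using dx by (intro subsetI) (smt (verit) dist_commute dist_triangle mem_cball)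
      have x: "x \<in> cball x0 (2 * r)" using dx r by (auto simp: dist_commute)
      let ?g = "\<lambda>\<zeta>. f (\<zeta>, u) - f (\<zeta>, u0)"
      have holg: "?g holomorphic_on cball x r"
        using hol[OF uu(1)] hol[OF uu(2)] sub by (intro holomorphic_intros) (auto intro: holomorphic_on_subset)
      have "norm ((deriv ^^ 1) ?g x) \<le> fact 1 * (e / 2 * r) / r ^ 1"
      proof (rule Cauchy_inequality)
        show "?g holomorphic_on ball x r" using holg by (rule holomorphic_on_subset) auto
        show "continuous_on (cball x r) ?g" using holg by (rule holomorphic_on_imp_continuous_on)
        fix w assume "norm (x - w) = r"
        then have "w \<in> cball x r" by (simp add: dist_norm)
        then have "w \<in> cball x0 (2 * r)" using sub by auto
        then have "dist (f (w, u)) (f (w, u0)) < e / 2 * r"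
          using uu du by (intro d1) (auto simp: dist_Pair_Pair dist_commute)
        then show "norm (f (w, u) - f (w, u0)) \<le> e / 2 * r" by (simp add: dist_norm)
      qed (use r in auto)
      moreover have "deriv ?g x = pdx f (x, u) - pdx f (x, u0)"
        unfolding pdx_def using deriv_diff[OF fd fd, of x u u0] uu x subsetD[OF r(2)] by auto
      ultimately have "norm (pdx f (x, u) - pdx f (x, u0)) \<le> e / 2"
        using r by simp
      moreover have "dist (pdx f (x, u0)) (pdx f (x0, u0)) < e / 2"
        using d2(2)[of x] dx by (simp add: pdx_def)
      ultimately show "dist (pdx f z) (pdx f (x0, u0)) < e"
        using dist_triangle[of "pdx f z" "pdx f (x0, u0)" "pdx f (x, u0)"] by (simp add: zx dist_norm)
    qed (use r d1 d2 in auto)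
  qed
qed

lemma continuous_on_pdu:
  assumes W: "open W" and sep: "sep_holomorphic f W"
  shows "continuous_on W (pdu f)"
proof -
  note sw = sep_holomorphic_swap[OF sep]
  have "continuous_on (prod.swap -` W) (pdx (f \<circ> prod.swap))"
    by (rule continuous_on_pdx[OF open_swap[OF W] sep_holomorphicD(1)[OF sw] sep_holomorphicD(2)[OF sw]])
  then show ?thesis
    unfolding pdu_conv_swap
    by (intro continuous_on_compose continuous_on_swap) (auto elim: continuous_on_subset)
qed

text \<open>The difference quotients in x converge uniformly for u near u0, so Weierstrass' theorem
  differentiates the limit in u. One limit thus serves both the holomorphy of \<open>pdx f\<close>
  in u and the equality of the mixed derivatives.\<close>

lemma pdx_diff_quotient:
  assumes W: "open W" and sep: "sep_holomorphic f W" and z: "(x0, u0) \<in> W"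
  obtains g' h where "((\<lambda>u. pdx f (x0, u)) has_field_derivative g') (at u0)"
    "h \<longlonglongrightarrow> 0" "\<And>n. h n \<noteq> (0::complex)"
    "(\<lambda>n. (pdu f (x0 + h n, u0) - pdu f (x0, u0)) / h n) \<longlonglongrightarrow> g'"
proof -
  obtain r where r: "r > 0" "cball x0 r \<times> cball u0 r \<subseteq> W"
    using open_polydisc[OF W z] .
  let ?K = "cball x0 r \<times> cball u0 r"
  \<comment> \<open>A sequence, because the Weierstrass theorem below is stated for sequences; its
    first term \<open>r\<close> still keeps \<open>x0 + h n\<close> in the closed disc.\<close>
  define h :: "nat \<Rightarrow> complex" where "h n = of_real (r / real (Suc n))" for n
  have hn: "h n \<noteq> 0" "norm (h n) \<le> r" for n
  proof -
    show "h n \<noteq> 0" using r by (simp add: h_def del: of_nat_Suc)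
    have "r / real (Suc n) \<le> r / 1" using r by (intro divide_left_mono) auto
    then show "norm (h n) \<le> r" using r by (simp add: h_def del: of_real_divide)
  qed
  have "(\<lambda>n. r / real (Suc n)) \<longlonglongrightarrow> 0"
    using LIMSEQ_Suc[OF tendsto_divide_0[OF tendsto_const filterlim_at_top_imp_at_infinity[OF filterlim_real_sequentially]]] .
  then have h0: "h \<longlonglongrightarrow> 0"
    unfolding h_def using tendsto_of_real[of _ 0, where 'a = complex] by (simp del: of_real_divide)
  note px = sep_holomorphicD(4)[OF sep] and pu = sep_holomorphicD(5)[OF sep]
  have "continuous_on W (pdx f)"
    by (rule continuous_on_pdx[OF W sep_holomorphicD(1)[OF sep] sep_holomorphicD(2)[OF sep]])
  then have uc: "uniformly_continuous_on ?K (pdx f)"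
    by (intro compact_uniformly_continuous) (use r in \<open>auto intro: continuous_on_subset compact_Times\<close>)
  have ul: "uniform_limit (ball u0 r) (\<lambda>n u. (f (x0 + h n, u) - f (x0, u)) / h n) (\<lambda>u. pdx f (x0, u)) sequentially"
  proof (rule uniform_limitI)
    fix e :: real assume e: "e > 0"
    obtain d where d: "d > 0" "\<And>z z'. z \<in> ?K \<Longrightarrow> z' \<in> ?K \<Longrightarrow> dist z' z < d \<Longrightarrow> dist (pdx f z') (pdx f z) < e / 2"
      using uc e unfolding uniformly_continuous_on_def by (metis half_gt_zero)
    have "\<forall>\<^sub>F n in sequentially. norm (h n) < d"
      using tendstoD[OF h0 d(1)] by simp
    then show "\<forall>\<^sub>F n in sequentially. \<forall>u\<in>ball u0 r. dist ((f (x0 + h n, u) - f (x0, u)) / h n) (pdx f (x0, u)) < e"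
    proof (eventually_elim, intro ballI)
      fix n u assume n: "norm (h n) < d" and u: "u \<in> ball u0 r"
      \<comment> \<open>Subtracting the linear function with slope \<open>pdx f (x0, u)\<close>
        turns the mean value inequality into an estimate of the quotient against its limit.\<close>
      let ?S = "cball x0 (norm (h n))" and ?g = "\<lambda>x. f (x, u) - x * pdx f (x0, u)"
      have S: "?S \<subseteq> cball x0 r" using hn(2)[of n] by auto
      have "norm (?g (x0 + h n) - ?g x0) \<le> e / 2 * norm (x0 + h n - x0)"
      proof (rule field_differentiable_bound[of ?S _ "\<lambda>x. pdx f (x, u) - pdx f (x0, u)"])
        fix x assume x: "x \<in> ?S"
        then have "(x, u) \<in> W" using S u by (intro subsetD[OF r(2)]) auto
        from px[OF this] show "(?g has_field_derivative pdx f (x, u) - pdx f (x0, u)) (at x within ?S)"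
          by (auto intro!: derivative_eq_intros intro: DERIV_subset)
        have "dist (pdx f (x, u)) (pdx f (x0, u)) < e / 2"
          using x S u n r by (intro d) (auto simp: dist_Pair_Pair dist_commute)
        then show "norm (pdx f (x, u) - pdx f (x0, u)) \<le> e / 2" by (simp add: dist_norm)
      qed (auto simp: dist_norm)
      moreover have "?g (x0 + h n) - ?g x0 = h n * ((f (x0 + h n, u) - f (x0, u)) / h n - pdx f (x0, u))"
        using hn by (simp add: field_simps)
      ultimately have "norm (h n) * norm ((f (x0 + h n, u) - f (x0, u)) / h n - pdx f (x0, u)) \<le> norm (h n) * (e / 2)"
        by (simp add: norm_mult mult.commute)
      then have "norm ((f (x0 + h n, u) - f (x0, u)) / h n - pdx f (x0, u)) \<le> e / 2"
        using hn by simp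
      then show "dist ((f (x0 + h n, u) - f (x0, u)) / h n) (pdx f (x0, u)) < e"
        using e by (simp add: dist_norm)
    qed
  qed
  have "\<exists>g'. \<forall>u\<in>ball u0 r. ((\<lambda>u. pdx f (x0, u)) has_field_derivative g' u) (at u) \<and>
      (\<lambda>n. (pdu f (x0 + h n, u) - pdu f (x0, u)) / h n) \<longlonglongrightarrow> g' u"
  proof (rule has_complex_derivative_uniform_sequence[where f = "\<lambda>n u. (f (x0 + h n, u) - f (x0, u)) / h n"])
    fix n u assume u: "u \<in> ball u0 r"
    have "(x0 + h n, u) \<in> W" "(x0, u) \<in> W"
      using u hn r by (auto simp: dist_norm)
    from pu[OF this(1)] pu[OF this(2)]
    show "((\<lambda>u. (f (x0 + h n, u) - f (x0, u)) / h n) has_field_derivative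
        (pdu f (x0 + h n, u) - pdu f (x0, u)) / h n) (at u)"
      using hn by (auto intro!: derivative_eq_intros)
  next
    fix u assume "u \<in> ball u0 r"
    then obtain d where "d > 0" "cball u d \<subseteq> ball u0 r"
      using open_contains_cball open_ball by metis
    with uniform_limit_on_subset[OF ul] show "\<exists>d>0. cball u d \<subseteq> ball u0 r \<and> uniform_limit (cball u d)
        (\<lambda>n u. (f (x0 + h n, u) - f (x0, u)) / h n) (\<lambda>u. pdx f (x0, u)) sequentially"
      by blast
  qed auto
  then obtain g' where g': "\<forall>u\<in>ball u0 r. ((\<lambda>u. pdx f (x0, u)) has_field_derivative g' u) (at u) \<and>
      (\<lambda>n. (pdu f (x0 + h n, u) - pdu f (x0, u)) / h n) \<longlonglongrightarrow> g' u" ..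
  have "u0 \<in> ball u0 r" using r by simp
  with g' show thesis
    by (intro that[OF _ h0 hn(1), of "g' u0"]) blast+
qed

lemma sep_holomorphic_pdx:
  assumes W: "open W" and sep: "sep_holomorphic f W"
  shows "sep_holomorphic (pdx f) W"
  unfolding sep_holomorphic_def
proof (intro conjI ballI)
  show "continuous_on W (pdx f)"
    by (rule continuous_on_pdx[OF W sep_holomorphicD(1)[OF sep] sep_holomorphicD(2)[OF sep]])
next
  fix z assume z: "z \<in> W"
  then obtain r where r: "r > 0" "cball (fst z) r \<times> cball (snd z) r \<subseteq> W"
    using open_polydisc[OF W, of "fst z" "snd z"] by auto
  have "(\<lambda>x. f (x, snd z)) holomorphic_on ball (fst z) r"
    by (rule holomorphic_onI, rule field_differentiable_at_within, rule sep_holomorphicD(2)[OF sep])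
      (use r in force)
  then have "deriv (\<lambda>x. f (x, snd z)) holomorphic_on ball (fst z) r"
    by (simp add: holomorphic_deriv)
  then show "(\<lambda>x. pdx f (x, snd z)) field_differentiable at (fst z)"
    using r by (auto simp: pdx_def intro: holomorphic_on_imp_differentiable_at)
  show "(\<lambda>u. pdx f (fst z, u)) field_differentiable at (snd z)"
    using pdx_diff_quotient[OF W sep, of "fst z" "snd z"] z field_differentiable_def
    by (metis prod.collapse)
qed

lemma sep_holomorphic_pdu:
  assumes W: "open W" and sep: "sep_holomorphic f W"
  shows "sep_holomorphic (pdu f) W"
proof -
  have "sep_holomorphic (pdx (f \<circ> prod.swap)) (prod.swap -` W)"
    by (rule sep_holomorphic_pdx[OF open_swap[OF W] sep_holomorphic_swap[OF sep]])
  from sep_holomorphic_swap[OF this] show ?thesis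
    by (simp add: pdu_conv_swap vimage_def)
qed

text \<open>The number \<open>g'\<close> of \<open>pdx_diff_quotient\<close> is the u-derivative of
  \<open>pdx f\<close> by one of its properties and the x-derivative of \<open>pdu f\<close> by the
  other.\<close>

lemma pdx_pdu_commute:
  assumes W: "open W" and sep: "sep_holomorphic f W" and z: "z \<in> W"
  shows "pdx (pdu f) z = pdu (pdx f) z"
proof -
  obtain x u where zx: "z = (x, u)" by (cases z)
  obtain g' h where g': "((\<lambda>u. pdx f (x, u)) has_field_derivative g') (at u)"
    and h: "h \<longlonglongrightarrow> 0" "\<And>n. h n \<noteq> 0"
    and lim: "(\<lambda>n. (pdu f (x + h n, u) - pdu f (x, u)) / h n) \<longlonglongrightarrow> g'"
    by (rule pdx_diff_quotient[OF W sep z[unfolded zx]]) (rule that)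
  have "((\<lambda>x. pdu f (x, u)) has_field_derivative pdx (pdu f) (x, u)) (at x)"
    using sep_holomorphicD(4)[OF sep_holomorphic_pdu[OF W sep]] z zx by simp
  then have "((\<lambda>h. (pdu f (x + h, u) - pdu f (x, u)) / h) \<longlongrightarrow> pdx (pdu f) (x, u)) (at 0)"
    by (simp add: DERIV_def)
  moreover have "filterlim h (at 0) sequentially"
    using h by (simp add: filterlim_at)
  ultimately have "(\<lambda>n. (pdu f (x + h n, u) - pdu f (x, u)) / h n) \<longlonglongrightarrow> pdx (pdu f) (x, u)"
    by (rule filterlim_compose)
  with lim have "pdx (pdu f) (x, u) = g'"
    by (rule LIMSEQ_unique[symmetric])
  with g' show ?thesis
    by (simp add: zx pdu_def DERIV_imp_deriv)
qed

lemma has_field_derivative_slices: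
  fixes f :: "complex \<times> complex \<Rightarrow> complex"
  assumes D: "(f has_derivative (\<lambda>h. p * fst h + q * snd h)) (at z)"
  shows "((\<lambda>x. f (x, snd z)) has_field_derivative p) (at (fst z))"
    and "((\<lambda>u. f (fst z, u)) has_field_derivative q) (at (snd z))"
proof -
  have "((\<lambda>x. (x, snd z)) has_derivative (\<lambda>h. (h, 0))) (at (fst z))"
    by (auto intro!: derivative_eq_intros)
  from has_derivative_compose[OF this, of f, simplified, OF D]
  show "((\<lambda>x. f (x, snd z)) has_field_derivative p) (at (fst z))"
    by (simp add: has_field_derivative_def)
  have "((\<lambda>u. (fst z, u)) has_derivative (\<lambda>h. (0, h))) (at (snd z))"
    by (auto intro!: derivative_eq_intros)
  from has_derivative_compose[OF this, of f, simplified, OF D]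
  show "((\<lambda>u. f (fst z, u)) has_field_derivative q) (at (snd z))"
    by (simp add: has_field_derivative_def)
qed

text \<open>From left to right by restriction to slices. From right to left, the partial derivatives
  and the continuity of \<open>pdu f\<close>, a consequence of Cauchy's inequality, give the total
  derivative.\<close>

lemma holomorphic2_iff_sep:
  assumes W: "open W"
  shows "holomorphic2_on f W \<longleftrightarrow> sep_holomorphic f W"
proof
  assume hol: "holomorphic2_on f W"
  show "sep_holomorphic f W"
    unfolding sep_holomorphic_def
  proof (intro conjI ballI)
    show "continuous_on W f"
      unfolding continuous_on_eq_continuous_within
      using hol has_derivative_continuous unfolding holomorphic2_on_def by blast
    fix z assume z: "z \<in> W"
    then obtain p q where "(f has_derivative (\<lambda>h. p * fst h + q * snd h)) (at z within W)"
      using hol unfolding holomorphic2_on_def by blast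
    then have D: "(f has_derivative (\<lambda>h. p * fst h + q * snd h)) (at z)"
      using at_within_open[OF z W] by simp
    show "(\<lambda>x. f (x, snd z)) field_differentiable at (fst z)"
      and "(\<lambda>u. f (fst z, u)) field_differentiable at (snd z)"
      using has_field_derivative_slices[OF D] unfolding field_differentiable_def by blast+
  qed
next
  assume sep: "sep_holomorphic f W"
  show "holomorphic2_on f W"
    unfolding holomorphic2_on_def
  proof (intro ballI exI)
    fix z assume z: "z \<in> W"
    obtain x u where zx: "z = (x, u)" by (cases z)
    obtain r where r: "r > 0" "cball x r \<times> cball u r \<subseteq> W"
      using open_polydisc[OF W z[unfolded zx]] .
    let ?X = "ball x r" and ?Y = "ball u r"
    have sub: "?X \<times> ?Y \<subseteq> W" using r by force
    have "((\<lambda>(x, u). f (x, u)) has_derivative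
        (\<lambda>(tx, tu). pdx f (x, u) * tx + blinfun_apply (blinfun_mult_right (pdu f (x, u))) tu)) (at (x, u) within ?X \<times> ?Y)"
    proof (rule has_derivative_partialsI)
      show "((\<lambda>x. f (x, u)) has_derivative (*) (pdx f (x, u))) (at x within ?X)"
        using sep_holomorphicD(4)[OF sep] z
        by (auto simp: zx has_field_derivative_def intro: has_derivative_at_withinI)
      fix x' u' assume "x' \<in> ?X" "u' \<in> ?Y"
      then have "(x', u') \<in> W" using sub by auto
      then show "((\<lambda>u. f (x', u)) has_derivative blinfun_apply (blinfun_mult_right (pdu f (x', u')))) (at u' within ?Y)"
        using sep_holomorphicD(5)[OF sep]
        by (auto simp: has_field_derivative_def intro: has_derivative_at_withinI)
    next
      have "continuous_on W (pdu f)"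
        by (rule continuous_on_pdu[OF W sep])
      then have "continuous (at (x, u) within ?X \<times> ?Y) (pdu f)"
        using z W by (simp add: zx continuous_on_eq_continuous_at continuous_at_imp_continuous_at_within)
      then show "continuous (at (x, u) within ?X \<times> ?Y) (\<lambda>(x, u). blinfun_mult_right (pdu f (x, u)))"
        by (simp add: case_prod_unfold bounded_linear.continuous[OF bounded_linear_blinfun_mult_right])
    qed (use r in auto)
    then have D: "(f has_derivative (\<lambda>h. pdx f z * fst h + pdu f z * snd h)) (at z within ?X \<times> ?Y)"
      by (simp add: zx case_prod_unfold)
    have "open (?X \<times> ?Y)" "z \<in> ?X \<times> ?Y"
      using r by (auto simp: zx open_Times)
    then have "at z within ?X \<times> ?Y = at z"
      by (intro at_within_open)
    with D have "(f has_derivative (\<lambda>h. pdx f z * fst h + pdu f z * snd h)) (at z)"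
      by simp
    then show "(f has_derivative (\<lambda>h. pdx f z * fst h + pdu f z * snd h)) (at z within W)"
      by (rule has_derivative_at_withinI)
  qed
qed

lemma holomorphic2_has_derivative:
  assumes W: "open W" and hol: "holomorphic2_on f W" and z: "z \<in> W"
  shows "(f has_derivative (\<lambda>h. pdx f z * fst h + pdu f z * snd h)) (at z)"
proof -
  obtain p q where "(f has_derivative (\<lambda>h. p * fst h + q * snd h)) (at z within W)"
    using hol z unfolding holomorphic2_on_def by blast
  then have D: "(f has_derivative (\<lambda>h. p * fst h + q * snd h)) (at z)"
    using at_within_open[OF z W] by simp
  have "p = pdx f z" "q = pdu f z"
    using has_field_derivative_slices[OF D] by (simp_all add: pdx_def pdu_def DERIV_imp_deriv)
  with D show ?thesis by simp
qed

lemma holomorphic2_chain: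
  assumes W: "open W" and hol: "holomorphic2_on f W" and z: "(\<xi> t, \<upsilon> t) \<in> W"
    and d: "(\<xi> has_field_derivative \<xi>') (at t)" "(\<upsilon> has_field_derivative \<upsilon>') (at t)"
  shows "((\<lambda>t. f (\<xi> t, \<upsilon> t)) has_field_derivative
           pdx f (\<xi> t, \<upsilon> t) * \<xi>' + pdu f (\<xi> t, \<upsilon> t) * \<upsilon>') (at t)"
proof -
  have "((\<lambda>t. (\<xi> t, \<upsilon> t)) has_derivative (\<lambda>h. (\<xi>' * h, \<upsilon>' * h))) (at t)"
    using d by (intro has_derivative_Pair) (simp_all add: has_field_derivative_def)
  from has_derivative_compose[OF this holomorphic2_has_derivative[OF W hol z]]
  show ?thesis
    unfolding has_field_derivative_def by (rule has_derivative_eq_rhs) (auto simp: algebra_simps)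
qed

lemma holomorphic2_on_pdx: "open W \<Longrightarrow> holomorphic2_on f W \<Longrightarrow> holomorphic2_on (pdx f) W"
  and holomorphic2_on_pdu: "open W \<Longrightarrow> holomorphic2_on f W \<Longrightarrow> holomorphic2_on (pdu f) W"
  by (simp_all add: holomorphic2_iff_sep sep_holomorphic_pdx sep_holomorphic_pdu)

lemma holomorphic2_imp_continuous_on: "open W \<Longrightarrow> holomorphic2_on f W \<Longrightarrow> continuous_on W f"
  by (simp add: holomorphic2_iff_sep sep_holomorphic_def)

section \<open>Algebraic closure properties of holomorphic functions of two variables\<close>

lemma holomorphic2_on_const: "holomorphic2_on (\<lambda>z. k) W"
  unfolding holomorphic2_on_def by (auto intro!: exI[of _ 0])

lemma holomorphic2_on_add:
  "open W \<Longrightarrow> holomorphic2_on f W \<Longrightarrow> holomorphic2_on g W \<Longrightarrow> holomorphic2_on (\<lambda>z. f z + g z) W"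
  and holomorphic2_on_diff:
  "open W \<Longrightarrow> holomorphic2_on f W \<Longrightarrow> holomorphic2_on g W \<Longrightarrow> holomorphic2_on (\<lambda>z. f z - g z) W"
  and holomorphic2_on_mult:
  "open W \<Longrightarrow> holomorphic2_on f W \<Longrightarrow> holomorphic2_on g W \<Longrightarrow> holomorphic2_on (\<lambda>z. f z * g z) W"
  by (simp_all add: holomorphic2_iff_sep sep_holomorphic_def continuous_intros
      field_differentiable_add field_differentiable_diff field_differentiable_mult)

lemma holomorphic2_on_divide:
  "open W \<Longrightarrow> holomorphic2_on f W \<Longrightarrow> holomorphic2_on g W \<Longrightarrow> (\<And>z. z \<in> W \<Longrightarrow> g z \<noteq> 0) \<Longrightarrow>
    holomorphic2_on (\<lambda>z. f z / g z) W"
  by (simp add: holomorphic2_iff_sep sep_holomorphic_def continuous_intros field_differentiable_divide)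

lemma holomorphic2_on_sum:
  "open W \<Longrightarrow> (\<And>i. i \<in> I \<Longrightarrow> holomorphic2_on (f i) W) \<Longrightarrow> holomorphic2_on (\<lambda>z. \<Sum>i\<in>I. f i z) W"
  by (induction I rule: infinite_finite_induct) (auto intro: holomorphic2_on_const holomorphic2_on_add)

lemma holomorphic2_on_prod:
  "open W \<Longrightarrow> (\<And>i. i \<in> I \<Longrightarrow> holomorphic2_on (f i) W) \<Longrightarrow> holomorphic2_on (\<lambda>z. \<Prod>i\<in>I. f i z) W"
  by (induction I rule: infinite_finite_induct) (auto intro: holomorphic2_on_const holomorphic2_on_mult)

lemma holomorphic2_on_cong:
  assumes "\<And>z. z \<in> W \<Longrightarrow> f z = g z"
  shows "holomorphic2_on f W \<longleftrightarrow> holomorphic2_on g W"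
proof -
  have "(f has_derivative D) (at z within W) \<longleftrightarrow> (g has_derivative D) (at z within W)" if "z \<in> W" for z D
    using has_derivative_transform[OF that, of f g D] has_derivative_transform[OF that, of g f D] assms
    by auto
  then show ?thesis
    unfolding holomorphic2_on_def by simp
qed

text \<open>Prepares Cramer's rule in \<open>local_coordinate_hol\<close>.\<close>

lemma holomorphic2_on_det:
  fixes M :: "complex \<times> complex \<Rightarrow> complex ^ 'n ^ 'n"
  assumes "open W" "\<And>i j. holomorphic2_on (\<lambda>z. M z $ i $ j) W"
  shows "holomorphic2_on (\<lambda>z. det (M z)) W"
  unfolding det_def
  by (intro holomorphic2_on_sum holomorphic2_on_mult holomorphic2_on_prod holomorphic2_on_const assms)

lemmas holomorphic2_intros =
  holomorphic2_on_const holomorphic2_on_add holomorphic2_on_diff holomorphic2_on_mult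
  holomorphic2_on_divide holomorphic2_on_pdx holomorphic2_on_pdu

section \<open>Holomorphic second-order differential equations\<close>

text \<open>A telescoping series dominated by a geometric one.\<close>

lemma uniform_limit_geometric:
  fixes g :: "nat \<Rightarrow> 'a \<Rightarrow> 'b::banach"
  assumes "\<And>n x. x \<in> S \<Longrightarrow> norm (g (Suc n) x - g n x) \<le> r / 2 ^ n"
  obtains l where "uniform_limit S g l sequentially"
proof -
  have "summable (\<lambda>n. r * (1 / 2) ^ n)"
    by (intro summable_mult summable_geometric) simp
  then have "uniform_limit S (\<lambda>n x. \<Sum>i<n. g (Suc i) x - g i x) (\<lambda>x. \<Sum>i. g (Suc i) x - g i x) sequentially"
    by (rule Weierstrass_m_test[rotated]) (use assms in \<open>simp add: power_divide\<close>)
  then have "uniform_limit S (\<lambda>n x. g n x - g 0 x) (\<lambda>x. \<Sum>i. g (Suc i) x - g i x) sequentially"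
    by (subst (asm) sum_lessThan_telescope)
  from uniform_limit_add[OF this uniform_limit_const[of "g 0" S]] show thesis
    using that by auto
qed

text \<open>Successive approximation; primitives on a disc take the place of the integrals.\<close>

lemma holomorphic_ode2_exists:
  fixes f :: "complex \<Rightarrow> complex \<Rightarrow> complex \<Rightarrow> complex"
  assumes r: "r > 0" and K: "K \<ge> 0"
    and hol: "\<And>S u v. \<lbrakk>open S; S \<subseteq> ball x0 r; u holomorphic_on S; v holomorphic_on S;
        u ` S \<subseteq> ball u0 r; v ` S \<subseteq> ball v0 r\<rbrakk> \<Longrightarrow> (\<lambda>x. f x (u x) (v x)) holomorphic_on S"
    and bound: "\<And>x u v. \<lbrakk>x \<in> ball x0 r; u \<in> ball u0 r; v \<in> ball v0 r\<rbrakk> \<Longrightarrow> norm (f x u v) \<le> M"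
    and lip: "\<And>x u v u' v'. \<lbrakk>x \<in> ball x0 r; u \<in> ball u0 r; v \<in> ball v0 r; u' \<in> ball u0 r; v' \<in> ball v0 r\<rbrakk>
        \<Longrightarrow> norm (f x u v - f x u' v') \<le> K * (norm (u - u') + norm (v - v'))"
  obtains s u where "s > 0" "s \<le> r" "u holomorphic_on ball x0 s" "u x0 = u0" "deriv u x0 = v0"
    "\<And>x. x \<in> ball x0 s \<Longrightarrow> u x \<in> ball u0 r"
    "\<And>x. x \<in> ball x0 s \<Longrightarrow> deriv (deriv u) x = f x (u x) (deriv u x)"
proof -
  have M: "M \<ge> 0"
    by (rule order_trans[OF norm_ge_zero bound[of x0 u0 v0]]) (use r in auto)
  \<comment> \<open>The bounds 1 / 2 and 1 / (4 (K + 1)) make each iteration halve the differences;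
    the last two keep the iterates of u and v within r / 2 of their initial values. The added 1
    avoids division by zero.\<close>
  define s where "s = Min {r, 1 / 2, 1 / (4 * (K + 1)), r / (2 * (norm v0 + r)), r / (2 * (M + 1))}"
  have s0: "s > 0"
    using r K M by (auto simp: s_def add_nonneg_pos)
  have sr: "s \<le> r" and s2: "s \<le> 1 / 2"
    unfolding s_def by (rule Min_le; simp)+
  have "s \<le> 1 / (4 * (K + 1))" unfolding s_def by (rule Min_le) auto
  then have sK: "s * (K * 2) \<le> 1 / 2"
    using K s0 by (simp add: field_simps)
  have "s \<le> r / (2 * (norm v0 + r))" unfolding s_def by (rule Min_le) auto
  then have sv: "(norm v0 + r) * s \<le> r / 2"
    using r add_nonneg_pos[of "norm v0" r] by (subst (asm) pos_le_divide_eq) (auto simp: algebra_simps)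
  have "s \<le> r / (2 * (M + 1))" unfolding s_def by (rule Min_le) auto
  then have sM: "M * s \<le> r / 2"
    using M s0 by (simp add: field_simps)
  let ?B = "ball x0 s"
  have x0: "x0 \<in> ?B" using s0 by simp
  have half: "x \<in> cball w (r / 2) \<Longrightarrow> x \<in> ball w r" for x w :: complex
    using r by auto
  \<comment> \<open>The mean value inequality from the centre, in the role of estimating an integral
    over a path of length at most \<open>s\<close>.\<close>
  have bd: "norm (g x) \<le> c * s" if "\<And>x. x \<in> ?B \<Longrightarrow> (g has_field_derivative g' x) (at x)" "g x0 = 0"
    "\<And>x. x \<in> ?B \<Longrightarrow> norm (g' x) \<le> c" "x \<in> ?B" for g g' :: "complex \<Rightarrow> complex" and c x
  proof -
    have "norm (g x - g x0) \<le> c * norm (x - x0)"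
      by (rule field_differentiable_bound[of ?B g g']) (use that x0 in \<open>auto intro: DERIV_subset\<close>)
    also have "\<dots> \<le> c * s"
      using that(3)[OF that(4)] that(4) norm_ge_zero[of "g' x"]
      by (intro mult_left_mono) (auto simp: dist_norm norm_minus_commute simp del: norm_ge_zero)
    finally show ?thesis using that(2) by simp
  qed
  have holB: "g holomorphic_on ?B" if "\<And>x. x \<in> ?B \<Longrightarrow> (g has_field_derivative g' x) (at x)" for g g'
    unfolding holomorphic_on_open[OF open_ball] using that by blast
  \<comment> \<open>Closed balls of half the radius: the limit functions then stay in the open balls
    of radius \<open>r\<close>, where \<open>lip\<close> applies.\<close>
  define G where "G = (\<lambda>(u, v). u holomorphic_on ?B \<and> v holomorphic_on ?B \<and> u x0 = u0 \<and> v x0 = v0 \<and>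
      (\<forall>x\<in>?B. u x \<in> cball u0 (r / 2) \<and> v x \<in> cball v0 (r / 2)))"
  define Q where "Q = (\<lambda>(u, v) (u', v'). \<forall>x\<in>?B. (u' has_field_derivative v x) (at x) \<and>
      (v' has_field_derivative f x (u x) (v x)) (at x))"
  \<comment> \<open>The primitives are known only to exist, so the iterates are obtained by
    dependent choice; \<open>Q\<close> is Picard's step for the first-order system u' = v, v' = f x
    u v.\<close>
  have "\<exists>q. \<forall>n. G (q n) \<and> Q (q n) (q (Suc n))"
  proof (rule dependent_nat_choice)
    show "\<exists>q. G q"
      using r by (intro exI[of _ "(\<lambda>_. u0, \<lambda>_. v0)"]) (auto simp: G_def)
    fix q :: "(complex \<Rightarrow> complex) \<times> (complex \<Rightarrow> complex)" and n :: nat assume q: "G q"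
    obtain u v where quv: "q = (u, v)" by (cases q)
    have uv: "u holomorphic_on ?B" "v holomorphic_on ?B"
      "\<And>x. x \<in> ?B \<Longrightarrow> u x \<in> cball u0 (r / 2)" "\<And>x. x \<in> ?B \<Longrightarrow> v x \<in> cball v0 (r / 2)"
      using q by (auto simp: G_def quv)
    \<comment> \<open>\<open>hol\<close> speaks of holomorphy along holomorphic curves, a substitute
      for joint holomorphy of \<open>f\<close> in three variables.\<close>
    have holf: "(\<lambda>x. f x (u x) (v x)) holomorphic_on ?B"
      by (rule hol) (use uv sr half in auto)
    have prim: "\<exists>p. \<forall>x\<in>?B. (p has_field_derivative g x) (at x)" if "g holomorphic_on ?B" for g
      using holomorphic_convex_primitive'[OF _ _ that] by (metis at_within_open convex_ball open_ball)
    obtain p where p: "\<And>x. x \<in> ?B \<Longrightarrow> (p has_field_derivative v x) (at x)"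
      using prim[OF uv(2)] by blast
    obtain p' where p': "\<And>x. x \<in> ?B \<Longrightarrow> (p' has_field_derivative f x (u x) (v x)) (at x)"
      using prim[OF holf] by blast
    let ?u = "\<lambda>x. p x - p x0 + u0" and ?v = "\<lambda>x. p' x - p' x0 + v0"
    have du: "(?u has_field_derivative v x) (at x)" and dv: "(?v has_field_derivative f x (u x) (v x)) (at x)"
      if "x \<in> ?B" for x
      using p[OF that] p'[OF that] by (auto intro!: derivative_eq_intros)
    have "norm (p x - p x0) \<le> (norm v0 + r) * s" if "x \<in> ?B" for x
    proof (rule bd[of "\<lambda>x. p x - p x0" v])
      fix y assume y: "y \<in> ?B"
      then show "((\<lambda>x. p x - p x0) has_field_derivative v y) (at y)"
        using p by (auto intro!: derivative_eq_intros)
      have "norm (v y - v0) \<le> r / 2" using uv(4)[OF y] by (simp add: dist_norm norm_minus_commute)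
      then show "norm (v y) \<le> norm v0 + r"
        using norm_triangle_sub[of "v y" v0] r by simp
    qed (use that in auto)
    moreover have "norm (p' x - p' x0) \<le> M * s" if "x \<in> ?B" for x
    proof (rule bd[of "\<lambda>x. p' x - p' x0" "\<lambda>x. f x (u x) (v x)"])
      fix y assume y: "y \<in> ?B"
      then show "((\<lambda>x. p' x - p' x0) has_field_derivative f y (u y) (v y)) (at y)"
        using p' by (auto intro!: derivative_eq_intros)
      show "norm (f y (u y) (v y)) \<le> M"
        by (rule bound) (use y sr uv half in auto)
    qed (use that in auto)
    ultimately have nb: "norm (p x - p x0) \<le> r / 2 \<and> norm (p' x - p' x0) \<le> r / 2" if "x \<in> ?B" for x
      using sv sM that by (meson order_trans)
    have dist_shift: "dist w (d + w) = norm d" for d w :: complex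
      by (simp add: dist_norm)
    have "?u holomorphic_on ?B" "?v holomorphic_on ?B"
      by (rule holB, erule du) (rule holB, erule dv)
    then have "G (?u, ?v)"
      using nb unfolding G_def by (simp add: dist_shift)
    moreover have "Q q (?u, ?v)"
      using du dv by (auto simp: Q_def quv)
    ultimately show "\<exists>q'. G q' \<and> Q q q'" by blast
  qed
  then obtain q where Gq: "\<And>n. G (q n)" and Qq: "\<And>n. Q (q n) (q (Suc n))" by blast
  define u v where "u n = fst (q n)" and "v n = snd (q n)" for n
  have quv: "q n = (u n, v n)" for n by (simp add: u_def v_def)
  have holuv: "u n holomorphic_on ?B" "v n holomorphic_on ?B"
    and uv0: "u n x0 = u0" "v n x0 = v0"
    and in2: "\<And>x. x \<in> ?B \<Longrightarrow> u n x \<in> cball u0 (r / 2)" "\<And>x. x \<in> ?B \<Longrightarrow> v n x \<in> cball v0 (r / 2)" for n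
    using Gq[of n] by (auto simp: G_def quv)
  have du: "x \<in> ?B \<Longrightarrow> (u (Suc n) has_field_derivative v n x) (at x)"
    and dv: "x \<in> ?B \<Longrightarrow> (v (Suc n) has_field_derivative f x (u n x) (v n x)) (at x)" for n x
    using Qq[of n] by (auto simp: Q_def quv)
  have diff: "\<forall>x\<in>?B. norm (u (Suc n) x - u n x) \<le> r / 2 ^ n \<and> norm (v (Suc n) x - v n x) \<le> r / 2 ^ n" for n
  proof (induction n)
    case 0
    have *: "norm (a - b) \<le> r" if "a \<in> cball w (r / 2)" "b \<in> cball w (r / 2)" for a b w :: complex
      using that dist_triangle[of a b w] by (simp add: dist_norm norm_minus_commute)
    show ?case using *[OF in2(1) in2(1)] *[OF in2(2) in2(2)] by simp
  next
    case (Suc n)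
    let ?c = "r / 2 ^ n"
    have c: "?c \<ge> 0" using r by simp
    show ?case
    proof (intro ballI conjI)
      fix x assume x: "x \<in> ?B"
      have "norm (u (Suc (Suc n)) x - u (Suc n) x) \<le> ?c * s"
        by (rule bd[of "\<lambda>x. u (Suc (Suc n)) x - u (Suc n) x" "\<lambda>x. v (Suc n) x - v n x"])
          (use du Suc uv0 x in \<open>auto intro!: derivative_eq_intros\<close>)
      also have "\<dots> \<le> ?c * (1 / 2)" using c s2 by (intro mult_left_mono)
      finally show "norm (u (Suc (Suc n)) x - u (Suc n) x) \<le> r / 2 ^ Suc n" by simp
      have "norm (v (Suc (Suc n)) x - v (Suc n) x) \<le> (K * (?c + ?c)) * s"
      proof (rule bd[of "\<lambda>x. v (Suc (Suc n)) x - v (Suc n) x"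
            "\<lambda>x. f x (u (Suc n) x) (v (Suc n) x) - f x (u n x) (v n x)"])
        fix y assume y: "y \<in> ?B"
        have "norm (f y (u (Suc n) y) (v (Suc n) y) - f y (u n y) (v n y))
          \<le> K * (norm (u (Suc n) y - u n y) + norm (v (Suc n) y - v n y))"
          by (rule lip) (use y sr half in2 in auto)
        also have "\<dots> \<le> K * (?c + ?c)"
          using Suc y K by (intro mult_left_mono add_mono) auto
        finally show "norm (f y (u (Suc n) y) (v (Suc n) y) - f y (u n y) (v n y)) \<le> K * (?c + ?c)" .
      qed (use dv uv0 x in \<open>auto intro!: derivative_eq_intros\<close>)
      also have "\<dots> = ?c * (s * (K * 2))" by (simp add: algebra_simps)
      also have "\<dots> \<le> ?c * (1 / 2)" using c sK by (intro mult_left_mono)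
      finally show "norm (v (Suc (Suc n)) x - v (Suc n) x) \<le> r / 2 ^ Suc n" by simp
    qed
  qed
  obtain U where U: "uniform_limit ?B u U sequentially"
    using uniform_limit_geometric[of ?B u r] diff by blast
  obtain V where V: "uniform_limit ?B v V sequentially"
    using uniform_limit_geometric[of ?B v r] diff by blast
  have limU: "(\<lambda>n. u n x) \<longlonglongrightarrow> U x" and limV: "(\<lambda>n. v n x) \<longlonglongrightarrow> V x" if "x \<in> ?B" for x
    using tendsto_uniform_limitI[OF U that] tendsto_uniform_limitI[OF V that] by auto
  have inU: "U x \<in> cball u0 (r / 2)" and inV: "V x \<in> cball v0 (r / 2)" if "x \<in> ?B" for x
    by (rule closed_sequentially[OF closed_cball in2(1)[OF that] limU[OF that]],
        rule closed_sequentially[OF closed_cball in2(2)[OF that] limV[OF that]])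
  \<comment> \<open>The index is shifted because the derivative of iterate n + 1 is expressed by
    iterate n.\<close>
  have loc: "\<exists>d>0. cball x d \<subseteq> ?B \<and> uniform_limit (cball x d) (\<lambda>n. g (Suc n)) l sequentially"
    if gl: "uniform_limit ?B g l sequentially" and "x \<in> ?B" for g l x
  proof -
    obtain d where d: "d > 0" "cball x d \<subseteq> ?B"
      using \<open>x \<in> ?B\<close> open_contains_cball open_ball by metis
    have "uniform_limit ?B (\<lambda>n. g (Suc n)) l sequentially"
      using gl unfolding uniform_limit_iff by (simp add: eventually_sequentially_Suc[of "\<lambda>n. \<forall>x\<in>?B. dist (g n x) (l x) < _"])
    with d show ?thesis
      using uniform_limit_on_subset by blast
  qed
  \<comment> \<open>Locally uniform limits may be differentiated termwise, so the relations of
    \<open>Q\<close> pass to the limit.\<close>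
  have dU: "(U has_field_derivative V x) (at x)" if x: "x \<in> ?B" for x
  proof -
    obtain g' where g': "\<forall>x\<in>?B. (U has_field_derivative g' x) (at x) \<and> (\<lambda>n. v n x) \<longlonglongrightarrow> g' x"
      using has_complex_derivative_uniform_sequence[OF open_ball du loc[OF U]] by blast
    then have "g' x = V x"
      using x limV LIMSEQ_unique by blast
    with bspec[OF g' x] show ?thesis by simp
  qed
  have dV: "(V has_field_derivative f x (U x) (V x)) (at x)" if x: "x \<in> ?B" for x
  proof -
    obtain g' where g': "\<forall>x\<in>?B. (V has_field_derivative g' x) (at x) \<and> (\<lambda>n. f x (u n x) (v n x)) \<longlonglongrightarrow> g' x"
      using has_complex_derivative_uniform_sequence[OF open_ball dv loc[OF V]] by blast
    have "(\<lambda>n. K * (norm (u n x - U x) + norm (v n x - V x))) \<longlonglongrightarrow> K * (norm (U x - U x) + norm (V x - V x))"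
      by (intro tendsto_intros limU limV x)
    then have "(\<lambda>n. K * (norm (u n x - U x) + norm (v n x - V x))) \<longlonglongrightarrow> 0" by simp
    moreover have bd: "norm (f x (u n x) (v n x) - f x (U x) (V x)) \<le> K * (norm (u n x - U x) + norm (v n x - V x))" for n
      by (rule lip) (use x sr half in2 inU inV in auto)
    ultimately have "(\<lambda>n. f x (u n x) (v n x) - f x (U x) (V x)) \<longlonglongrightarrow> 0"
      by (intro Lim_null_comparison[OF always_eventually[OF allI[OF bd]]])
    then have "(\<lambda>n. f x (u n x) (v n x)) \<longlonglongrightarrow> f x (U x) (V x)"
      by (simp add: LIM_zero_iff)
    then have "g' x = f x (U x) (V x)"
      using g' x LIMSEQ_unique by blast
    with bspec[OF g' x] show ?thesis by simp
  qed
  have derU: "deriv U x = V x" if "x \<in> ?B" for x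
    using dU[OF that] by (rule DERIV_imp_deriv)
  show thesis
  proof (rule that[OF s0 sr, of U])
    show "U holomorphic_on ?B"
      by (rule holB) (rule dU)
    show "U x0 = u0" "deriv U x0 = v0"
      using limU[OF x0] limV[OF x0] derU[OF x0] by (simp_all add: uv0 LIMSEQ_const_iff)
    fix x assume x: "x \<in> ?B"
    show "U x \<in> ball u0 r" using inU[OF x] half by blast
    have "deriv (deriv U) x = deriv V x"
      by (rule deriv_cong_ev[OF eventually_nhds_in_open[OF open_ball x, THEN eventually_mono]])
        (use derU in auto)
    also have "\<dots> = f x (U x) (deriv U x)"
      using dV[OF x] derU[OF x] by (simp add: DERIV_imp_deriv)
    finally show "deriv (deriv U) x = f x (U x) (deriv U x)" .
  qed
qed

text \<open>On a small closed disc let h = |u - w| + |u' - w'| attain its maximum at z. The mean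
  value inequality from x0 gives h(z) \<le> h(z) (K + 1) s, and (K + 1) s < 1 forces h = 0.\<close>

lemma holomorphic_ode2_unique:
  fixes f :: "complex \<Rightarrow> complex \<Rightarrow> complex \<Rightarrow> complex"
  assumes r: "r > 0" and K: "K \<ge> 0"
    and lip: "\<And>x u v u' v'. \<lbrakk>x \<in> ball x0 r; u \<in> ball (w x0) r; v \<in> ball (deriv w x0) r;
          u' \<in> ball (w x0) r; v' \<in> ball (deriv w x0) r\<rbrakk>
        \<Longrightarrow> norm (f x u v - f x u' v') \<le> K * (norm (u - u') + norm (v - v'))"
    and S: "open S" "x0 \<in> S" and hol: "u holomorphic_on S" "w holomorphic_on S"
    and init: "u x0 = w x0" "deriv u x0 = deriv w x0"
    and ode: "\<And>x. x \<in> S \<Longrightarrow> deriv (deriv u) x = f x (u x) (deriv u x)"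
      "\<And>x. x \<in> S \<Longrightarrow> deriv (deriv w) x = f x (w x) (deriv w x)"
  shows "\<forall>\<^sub>F x in nhds x0. u x = w x"
proof -
  have hol': "deriv u holomorphic_on S" "deriv w holomorphic_on S"
    using hol S by (auto intro: holomorphic_deriv)
  have near: "\<forall>\<^sub>F x in nhds x0. g x \<in> ball (g x0) r" if "g holomorphic_on S" for g
  proof -
    have "isCont g x0"
      using that S by (metis continuous_on_eq_continuous_at holomorphic_on_imp_continuous_on)
    then have "\<forall>\<^sub>F x in nhds x0. dist (g x) (g x0) < r"
      using r by (metis isCont_def tendstoD tendsto_at_iff_tendsto_nhds)
    then show ?thesis by (simp add: dist_commute)
  qed
  have "x0 \<in> ball x0 (min r (1 / (K + 2)))" using r K by simp
  then have "\<forall>\<^sub>F x in nhds x0. x \<in> ball x0 (min r (1 / (K + 2)))"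
    by (rule eventually_nhds_in_open[OF open_ball])
  then have "\<forall>\<^sub>F x in nhds x0. x \<in> S \<and> x \<in> ball x0 (min r (1 / (K + 2))) \<and> u x \<in> ball (w x0) r \<and> deriv u x \<in> ball (deriv w x0) r
      \<and> w x \<in> ball (w x0) r \<and> deriv w x \<in> ball (deriv w x0) r"
    using near[OF hol(1)] near[OF hol(2)] near[OF hol'(1)] near[OF hol'(2)] eventually_nhds_in_open[OF S] init
    by (intro eventually_conj) auto
  then obtain T where T: "open T" "x0 \<in> T" and T': "\<And>x. x \<in> T \<Longrightarrow> x \<in> S \<and> x \<in> ball x0 (min r (1 / (K + 2))) \<and>
      u x \<in> ball (w x0) r \<and> deriv u x \<in> ball (deriv w x0) r
      \<and> w x \<in> ball (w x0) r \<and> deriv w x \<in> ball (deriv w x0) r"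
    unfolding eventually_nhds by blast
  obtain s where s: "s > 0" "cball x0 s \<subseteq> T"
    using T open_contains_cball by metis
  let ?B = "cball x0 s"
  have sK: "s < 1 / (K + 2)"
  proof -
    \<comment> \<open>This boundary point of the closed disc lies in \<open>T\<close>, which bounds
      the radius \<open>s\<close> itself.\<close>
    have "x0 + of_real s \<in> ?B" using s by (simp add: dist_norm)
    with s T' have "x0 + of_real s \<in> ball x0 (1 / (K + 2))" by (auto dest!: subsetD)
    then show ?thesis using s by (simp add: dist_norm)
  qed
  have inS: "x \<in> ?B \<Longrightarrow> x \<in> S" for x using s T' by blast
  let ?h = "\<lambda>x. norm (u x - w x) + norm (deriv u x - deriv w x)"
  have "continuous_on ?B ?h"
    using hol hol' inS
    by (intro continuous_intros holomorphic_on_imp_continuous_on) (auto intro: holomorphic_on_subset)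
  then obtain z where z: "z \<in> ?B" and zmax: "\<And>x. x \<in> ?B \<Longrightarrow> ?h x \<le> ?h z"
    using continuous_attains_sup[of ?B ?h] s by auto
  have m0: "?h z \<ge> 0" by simp
  have df: "(g has_field_derivative deriv g x) (at x within ?B)" if "x \<in> ?B" "g holomorphic_on S" for g x
    using that S inS by (metis DERIV_subset holomorphic_derivI subset_UNIV)
  have "norm ((u z - w z) - (u x0 - w x0)) \<le> ?h z * norm (z - x0)"
  proof (rule field_differentiable_bound[of ?B _ "\<lambda>x. deriv u x - deriv w x"])
    fix x assume x: "x \<in> ?B"
    show "((\<lambda>x. u x - w x) has_field_derivative deriv u x - deriv w x) (at x within ?B)"
      using x hol by (intro DERIV_diff df)
    show "norm (deriv u x - deriv w x) \<le> ?h z"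
      using zmax[OF x] norm_ge_zero[of "u x - w x"] by linarith
  qed (use z s in auto)
  also have "\<dots> \<le> ?h z * s"
    using z m0 by (intro mult_left_mono) (auto simp: dist_norm norm_minus_commute)
  finally have 1: "norm (u z - w z) \<le> ?h z * s" using init by simp
  have "norm ((deriv u z - deriv w z) - (deriv u x0 - deriv w x0)) \<le> (K * ?h z) * norm (z - x0)"
  proof (rule field_differentiable_bound[of ?B _ "\<lambda>x. deriv (deriv u) x - deriv (deriv w) x"])
    fix x assume x: "x \<in> ?B"
    show "((\<lambda>x. deriv u x - deriv w x) has_field_derivative deriv (deriv u) x - deriv (deriv w) x) (at x within ?B)"
      using x hol' by (intro DERIV_diff df)
    have "norm (f x (u x) (deriv u x) - f x (w x) (deriv w x)) \<le> K * ?h x"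
      by (rule lip) (use T' s x in \<open>auto dest!: subsetD\<close>)
    also have "\<dots> \<le> K * ?h z" using zmax[OF x] K by (intro mult_left_mono)
    finally show "norm (deriv (deriv u) x - deriv (deriv w) x) \<le> K * ?h z"
      using ode inS x by simp
  qed (use z s in auto)
  also have "\<dots> \<le> (K * ?h z) * s"
    using z m0 K by (intro mult_left_mono) (auto simp: dist_norm norm_minus_commute)
  finally have 2: "norm (deriv u z - deriv w z) \<le> K * ?h z * s" using init by simp
  have "?h z \<le> ?h z * ((K + 1) * s)"
    using 1 2 by (simp add: algebra_simps)
  moreover have "(K + 1) * s < 1"
  proof -
    have "(K + 1) * s \<le> (K + 2) * s" using s by simp
    also have "\<dots> < 1" using sK K by (simp add: field_simps)
    finally show ?thesis .
  qed
  ultimately have "?h z \<le> 0"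
    using mult_less_cancel_left_pos[of "?h z" "(K + 1) * s" 1] by argo
  then have "u x = w x" if "x \<in> ?B" for x
    using zmax[OF that] norm_ge_zero[of "u x - w x"] norm_ge_zero[of "deriv u x - deriv w x"]
    by (metis add_nonneg_eq_0_iff dual_order.antisym eq_iff_diff_eq_0 m0 norm_eq_zero add_nonneg_nonneg)
  moreover have "\<forall>\<^sub>F x in nhds x0. x \<in> ball x0 s"
    using s by (intro eventually_nhds_in_open) auto
  ultimately show ?thesis
    by (auto elim!: eventually_mono)
qed

section \<open>Geodesics\<close>

lemma holomorphic2_compose_holomorphic:
  assumes W: "open W" and f: "holomorphic2_on f W" and S: "open S"
    and hol: "\<xi> holomorphic_on S" "\<upsilon> holomorphic_on S" and sub: "\<And>t. t \<in> S \<Longrightarrow> (\<xi> t, \<upsilon> t) \<in> W"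
  shows "(\<lambda>t. f (\<xi> t, \<upsilon> t)) holomorphic_on S"
proof -
  have "((\<lambda>t. f (\<xi> t, \<upsilon> t)) has_field_derivative
      pdx f (\<xi> t, \<upsilon> t) * deriv \<xi> t + pdu f (\<xi> t, \<upsilon> t) * deriv \<upsilon> t) (at t)" if "t \<in> S" for t
    by (rule holomorphic2_chain[OF W f sub[OF that] holomorphic_derivI[OF hol(1) S that] holomorphic_derivI[OF hol(2) S that]])
  then show ?thesis
    unfolding holomorphic_on_open[OF S] by blast
qed

text \<open>The two estimates that the lemmas on differential equations ask for. Boundedness makes
  products Lipschitz again, so the right-hand side, a cubic in the slope, is handled term by
  term.\<close>

definition tame :: "real \<Rightarrow> complex \<Rightarrow> complex \<Rightarrow> complex \<Rightarrow> (complex \<Rightarrow> complex \<Rightarrow> complex \<Rightarrow> complex) \<Rightarrow> bool" where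
  "tame r x0 u0 v0 h \<longleftrightarrow> (\<exists>M\<ge>0. \<exists>K\<ge>0. \<forall>x\<in>ball x0 r. \<forall>u\<in>ball u0 r. \<forall>v\<in>ball v0 r. \<forall>u'\<in>ball u0 r. \<forall>v'\<in>ball v0 r.
     norm (h x u v) \<le> M \<and> norm (h x u v - h x u' v') \<le> K * (norm (u - u') + norm (v - v')))"

lemma tameI:
  assumes "M \<ge> 0" "K \<ge> 0"
    and "\<And>x u v u' v'. \<lbrakk>x \<in> ball x0 r; u \<in> ball u0 r; v \<in> ball v0 r; u' \<in> ball u0 r; v' \<in> ball v0 r\<rbrakk>
      \<Longrightarrow> norm (h x u v) \<le> M \<and> norm (h x u v - h x u' v') \<le> K * (norm (u - u') + norm (v - v'))"
  shows "tame r x0 u0 v0 h"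
  unfolding tame_def using assms by blast

lemma tameE:
  assumes "tame r x0 u0 v0 h"
  obtains M K where "M \<ge> 0" "K \<ge> 0"
    "\<And>x u v u' v'. \<lbrakk>x \<in> ball x0 r; u \<in> ball u0 r; v \<in> ball v0 r; u' \<in> ball u0 r; v' \<in> ball v0 r\<rbrakk>
      \<Longrightarrow> norm (h x u v) \<le> M \<and> norm (h x u v - h x u' v') \<le> K * (norm (u - u') + norm (v - v'))"
  using assms unfolding tame_def by blast

lemma tame_add:
  assumes "tame r x0 u0 v0 h" "tame r x0 u0 v0 g"
  shows "tame r x0 u0 v0 (\<lambda>x u v. h x u v + g x u v)"
proof -
  obtain M K where M: "M \<ge> 0" "K \<ge> 0" and h: "\<And>x u v u' v'. \<lbrakk>x \<in> ball x0 r; u \<in> ball u0 r; v \<in> ball v0 r;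
      u' \<in> ball u0 r; v' \<in> ball v0 r\<rbrakk> \<Longrightarrow> norm (h x u v) \<le> M \<and> norm (h x u v - h x u' v') \<le> K * (norm (u - u') + norm (v - v'))"
    by (rule tameE[OF assms(1)]) (rule that)
  obtain N L where N: "N \<ge> 0" "L \<ge> 0" and g: "\<And>x u v u' v'. \<lbrakk>x \<in> ball x0 r; u \<in> ball u0 r; v \<in> ball v0 r;
      u' \<in> ball u0 r; v' \<in> ball v0 r\<rbrakk> \<Longrightarrow> norm (g x u v) \<le> N \<and> norm (g x u v - g x u' v') \<le> L * (norm (u - u') + norm (v - v'))"
    by (rule tameE[OF assms(2)]) (rule that)
  show ?thesis
  proof (rule tameI[of "M + N" "K + L"], goal_cases)
    case (3 x u v u' v')
    note * = this
    have bd: "norm (h x u v + g x u v) \<le> M + N"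
      using h[OF *] g[OF *] norm_triangle_ineq[of "h x u v" "g x u v"] by linarith
    have "h x u v + g x u v - (h x u' v' + g x u' v') = (h x u v - h x u' v') + (g x u v - g x u' v')"
      by simp
    also have "norm \<dots> \<le> K * (norm (u - u') + norm (v - v')) + L * (norm (u - u') + norm (v - v'))"
      using h[OF *] g[OF *] by (intro norm_triangle_le add_mono) auto
    finally show ?case
      using bd by (simp add: distrib_right)
  qed (use M N in auto)
qed

lemma tame_mult:
  assumes "tame r x0 u0 v0 h" "tame r x0 u0 v0 g"
  shows "tame r x0 u0 v0 (\<lambda>x u v. h x u v * g x u v)"
proof -
  obtain M K where M: "M \<ge> 0" "K \<ge> 0" and h: "\<And>x u v u' v'. \<lbrakk>x \<in> ball x0 r; u \<in> ball u0 r; v \<in> ball v0 r;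
      u' \<in> ball u0 r; v' \<in> ball v0 r\<rbrakk> \<Longrightarrow> norm (h x u v) \<le> M \<and> norm (h x u v - h x u' v') \<le> K * (norm (u - u') + norm (v - v'))"
    by (rule tameE[OF assms(1)]) (rule that)
  obtain N L where N: "N \<ge> 0" "L \<ge> 0" and g: "\<And>x u v u' v'. \<lbrakk>x \<in> ball x0 r; u \<in> ball u0 r; v \<in> ball v0 r;
      u' \<in> ball u0 r; v' \<in> ball v0 r\<rbrakk> \<Longrightarrow> norm (g x u v) \<le> N \<and> norm (g x u v - g x u' v') \<le> L * (norm (u - u') + norm (v - v'))"
    by (rule tameE[OF assms(2)]) (rule that)
  show ?thesis
  proof (rule tameI[of "M * N" "M * L + N * K"], goal_cases)
    case (3 x u v u' v')
    note * = this
    let ?d = "norm (u - u') + norm (v - v')"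
    have bd: "norm (h x u v * g x u v) \<le> M * N"
      using h[OF *] g[OF *] M unfolding norm_mult by (intro mult_mono) auto
    have "h x u v * g x u v - h x u' v' * g x u' v'
        = h x u v * (g x u v - g x u' v') + g x u' v' * (h x u v - h x u' v')"
      by (simp add: algebra_simps)
    \<comment> \<open>The factor \<open>g\<close> has to be bounded at (u', v'), hence the instance
      with the two points interchanged.\<close>
    also have "norm \<dots> \<le> M * (L * ?d) + N * (K * ?d)"
      using h[OF *] g[OF *] g[OF *(1,4,5,2,3)] M N
      by (intro norm_triangle_le add_mono) (auto simp: norm_mult intro!: mult_mono)
    finally show ?case
      using bd by (simp add: algebra_simps)
  qed (use M N in auto)
qed

lemma tame_slope: "tame r x0 u0 v0 (\<lambda>x u v. v)"
proof (rule tameI[of "norm v0 + \<bar>r\<bar>" 1], goal_cases)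
  case (3 x u v u' v')
  then have "norm (v - v0) \<le> \<bar>r\<bar>" by (simp add: dist_norm norm_minus_commute)
  then show ?case using norm_triangle_sub[of v v0] by simp
qed auto

text \<open>Compactness of the closed polydisc bounds \<open>g\<close> and \<open>pdu g\<close>; the
  mean value inequality turns the second bound into a Lipschitz constant.\<close>

lemma tame_coefficient:
  assumes W: "open W" and g: "holomorphic2_on g W" and sub: "cball x0 r \<times> cball u0 r \<subseteq> W"
  shows "tame r x0 u0 v0 (\<lambda>x u v. g (x, u))"
proof -
  have "\<exists>M\<ge>0. \<forall>z\<in>cball x0 r \<times> cball u0 r. norm (f z) \<le> M" if "holomorphic2_on f W" for f
  proof -
    have "continuous_on (cball x0 r \<times> cball u0 r) f"
      using holomorphic2_imp_continuous_on[OF W that] sub by (rule continuous_on_subset)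
    then have "bounded (f ` (cball x0 r \<times> cball u0 r))"
      by (intro compact_imp_bounded compact_continuous_image compact_Times compact_cball)
    then obtain M where "M > 0" "\<And>z. z \<in> cball x0 r \<times> cball u0 r \<Longrightarrow> norm (f z) \<le> M"
      unfolding bounded_pos by auto
    then show ?thesis by (intro exI[of _ M]) auto
  qed
  from this[OF g] this[OF holomorphic2_on_pdu[OF W g]]
  obtain M K where M: "M \<ge> 0" "\<And>z. z \<in> cball x0 r \<times> cball u0 r \<Longrightarrow> norm (g z) \<le> M"
    and K: "K \<ge> 0" "\<And>z. z \<in> cball x0 r \<times> cball u0 r \<Longrightarrow> norm (pdu g z) \<le> K" by auto
  show ?thesis
  proof (rule tameI[of M K], intro M, intro K, intro conjI)
    fix x u v u' v'
    assume x: "x \<in> ball x0 r" and u: "u \<in> ball u0 r" "u' \<in> ball u0 r"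
    show "norm (g (x, u)) \<le> M"
      using x u by (intro M) auto
    have "norm (g (x, u) - g (x, u')) \<le> K * norm (u - u')"
    proof (rule field_differentiable_bound[of "ball u0 r" _ "\<lambda>u. pdu g (x, u)"])
      fix t assume t: "t \<in> ball u0 r"
      then have "(x, t) \<in> W" using x by (intro subsetD[OF sub]) auto
      then have "((\<lambda>u. g (x, u)) has_field_derivative pdu g (x, t)) (at t)"
        using g W by (simp add: holomorphic2_iff_sep sep_holomorphicD)
      then show "((\<lambda>u. g (x, u)) has_field_derivative pdu g (x, t)) (at t within ball u0 r)"
        by (rule DERIV_subset) auto
      show "norm (pdu g (x, t)) \<le> K"
        using x t by (intro K) auto
    qed (use u in auto)
    also have "\<dots> \<le> K * (norm (u - u') + norm (v - v'))"
      using K by (intro mult_left_mono) auto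
    finally show "norm (g (x, u) - g (x, u')) \<le> K * (norm (u - u') + norm (v - v'))" .
  qed
qed

lemma geodesics_one_parameter_holomorphic:
  assumes W: "open W" and ABCD: "holomorphic2_on A W" "holomorphic2_on B W" "holomorphic2_on C W" "holomorphic2_on D W"
    and P: "P \<in> W"
  shows "geodesics_one_parameter W A B C D P"
proof -
  obtain x0 u0 where Pxu: "P = (x0, u0)" by (cases P)
  obtain r where r: "r > 0" "cball x0 r \<times> cball u0 r \<subseteq> W"
    using open_polydisc[OF W P[unfolded Pxu]] .
  let ?f = "\<lambda>x u v. A (x, u) + B (x, u) * v + C (x, u) * v\<^sup>2 + D (x, u) * v ^ 3"
  \<comment> \<open>The radius \<open>r\<close> serves all slopes at once, while the constants
    \<open>M\<close> and \<open>K\<close> depend on the slope \<open>v0\<close>.\<close>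
  have "tame r x0 u0 v0 ?f" for v0
    unfolding power2_eq_square power3_eq_cube
    by (intro tame_add tame_mult tame_slope tame_coefficient[OF W _ r(2)] ABCD)
  then have "\<forall>v0. \<exists>M K. K \<ge> 0 \<and> (\<forall>x\<in>ball x0 r. \<forall>u\<in>ball u0 r. \<forall>v\<in>ball v0 r. \<forall>u'\<in>ball u0 r. \<forall>v'\<in>ball v0 r.
     norm (?f x u v) \<le> M \<and> norm (?f x u v - ?f x u' v') \<le> K * (norm (u - u') + norm (v - v')))"
    unfolding tame_def by blast
  then obtain M K where K: "\<And>v0. K v0 \<ge> 0"
    and bounds: "\<And>v0. \<forall>x\<in>ball x0 r. \<forall>u\<in>ball u0 r. \<forall>v\<in>ball v0 r. \<forall>u'\<in>ball u0 r. \<forall>v'\<in>ball v0 r.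
      norm (?f x u v) \<le> M v0 \<and> norm (?f x u v - ?f x u' v') \<le> K v0 * (norm (u - u') + norm (v - v'))"
    by metis
  have lip: "norm (?f x u v - ?f x u' v') \<le> K v0 * (norm (u - u') + norm (v - v'))"
    if "x \<in> ball x0 r" "u \<in> ball u0 r" "v \<in> ball v0 r" "u' \<in> ball u0 r" "v' \<in> ball v0 r" for x u v u' v' v0
    using bounds that by blast
  show ?thesis
    unfolding geodesics_one_parameter_def
  proof (intro conjI allI impI)
    fix p
    obtain s u where s: "s > 0" "s \<le> r" "u holomorphic_on ball x0 s" "u x0 = u0" "deriv u x0 = p"
      "\<And>x. x \<in> ball x0 s \<Longrightarrow> u x \<in> ball u0 r"
      "\<And>x. x \<in> ball x0 s \<Longrightarrow> deriv (deriv u) x = ?f x (u x) (deriv u x)"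
    proof (rule holomorphic_ode2_exists[of r "K p" x0 u0 p ?f "M p"])
      fix S u v assume S: "open S" "S \<subseteq> ball x0 r" "u holomorphic_on S" "v holomorphic_on S" "u ` S \<subseteq> ball u0 r"
      have "(x, u x) \<in> W" if "x \<in> S" for x
        using that S by (intro subsetD[OF r(2)]) force
      then show "(\<lambda>x. ?f x (u x) (v x)) holomorphic_on S"
        using S by (intro holomorphic_intros holomorphic2_compose_holomorphic[OF W] ABCD) auto
    next
      show "norm (?f x u v) \<le> M p" if "x \<in> ball x0 r" "u \<in> ball u0 r" "v \<in> ball p r" for x u v
        using bounds that by blast
    qed (use r K lip in auto)
    have "(x, u x) \<in> W" if "x \<in> ball x0 s" for x
      using that s by (intro subsetD[OF r(2)]) force
    then show "\<exists>X u. geodesic_through W A B C D P X u \<and> deriv u (fst P) = p"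
      using s unfolding geodesic_through_def geodesic_def
      by (intro exI[of _ "ball x0 s"] exI[of _ u]) (auto simp: Pxu)
  next
    fix X u X' w
    assume *: "geodesic_through W A B C D P X u \<and> geodesic_through W A B C D P X' w \<and> deriv u (fst P) = deriv w (fst P)"
    then have X: "open (X \<inter> X')" "x0 \<in> X \<inter> X'" "u holomorphic_on X \<inter> X'" "w holomorphic_on X \<inter> X'"
      and init: "u x0 = u0" "w x0 = u0" "deriv u x0 = deriv w x0"
      and ode: "\<And>x. x \<in> X \<inter> X' \<Longrightarrow> deriv (deriv u) x = ?f x (u x) (deriv u x)"
        "\<And>x. x \<in> X \<inter> X' \<Longrightarrow> deriv (deriv w) x = ?f x (w x) (deriv w x)"
      by (auto simp: geodesic_through_def geodesic_def Pxu intro: holomorphic_on_subset)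
    have "\<forall>\<^sub>F x in nhds x0. u x = w x"
      by (rule holomorphic_ode2_unique[OF r(1) K[of "deriv w x0"] lip X _ _ ode]) (use init in auto)
    then show "\<forall>\<^sub>F x in nhds (fst P). u x = w x" by (simp add: Pxu)
  qed
qed

section \<open>The geodesic equation in an arbitrary parameter\<close>

lemma deriv2_compose:
  assumes X: "open X" "u holomorphic_on X" and S: "open S" "\<xi> holomorphic_on S" "\<xi> ` S \<subseteq> X"
    and eq: "\<And>t. t \<in> S \<Longrightarrow> \<upsilon> t = u (\<xi> t)" and t: "t \<in> S"
  shows "deriv \<upsilon> t = deriv u (\<xi> t) * deriv \<xi> t"
    and "deriv (deriv \<upsilon>) t = deriv (deriv u) (\<xi> t) * (deriv \<xi> t)\<^sup>2 + deriv u (\<xi> t) * deriv (deriv \<xi>) t"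
proof -
  have d1: "(\<upsilon> has_field_derivative deriv u (\<xi> t) * deriv \<xi> t) (at t)" if t: "t \<in> S" for t
  proof (rule has_field_derivative_transform_within_open[OF _ S(1) t])
    show "((\<lambda>t. u (\<xi> t)) has_field_derivative deriv u (\<xi> t) * deriv \<xi> t) (at t)"
      by (rule DERIV_chain2) (use X S t in \<open>auto intro: holomorphic_derivI\<close>)
  qed (simp add: eq)
  show "deriv \<upsilon> t = deriv u (\<xi> t) * deriv \<xi> t"
    using d1[OF t] by (rule DERIV_imp_deriv)
  have "((\<lambda>t. deriv u (\<xi> t) * deriv \<xi> t) has_field_derivative
      deriv (deriv u) (\<xi> t) * (deriv \<xi> t)\<^sup>2 + deriv u (\<xi> t) * deriv (deriv \<xi>) t) (at t)"
  proof -
    have "((\<lambda>t. deriv u (\<xi> t)) has_field_derivative deriv (deriv u) (\<xi> t) * deriv \<xi> t) (at t)"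
      by (rule DERIV_chain2) (use X S t in \<open>auto intro: holomorphic_derivI holomorphic_deriv\<close>)
    moreover have "(deriv \<xi> has_field_derivative deriv (deriv \<xi>) t) (at t)"
      using S t by (auto intro: holomorphic_derivI holomorphic_deriv)
    ultimately show ?thesis
      by (auto intro!: derivative_eq_intros simp: power2_eq_square)
  qed
  then have "(deriv \<upsilon> has_field_derivative
      deriv (deriv u) (\<xi> t) * (deriv \<xi> t)\<^sup>2 + deriv u (\<xi> t) * deriv (deriv \<xi>) t) (at t)"
    by (rule has_field_derivative_transform_within_open[OF _ S(1) t]) (simp add: DERIV_imp_deriv[OF d1])
  then show "deriv (deriv \<upsilon>) t = deriv (deriv u) (\<xi> t) * (deriv \<xi> t)\<^sup>2 + deriv u (\<xi> t) * deriv (deriv \<xi>) t"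
    by (rule DERIV_imp_deriv)
qed

text \<open>For \<upsilon> = u \<circ> \<xi> the terms with \<xi>'' cancel and the left-hand side
  becomes u'' \<xi>'^3, so both sides are \<xi>'^3 times those of the equation for u. Since \<xi>'
  does not vanish at t0, the curve is locally such a graph, with u the composition of \<upsilon> and
  a local inverse of \<xi>.\<close>

lemma geodesic_parametric_iff:
  assumes T: "open T" "\<xi> holomorphic_on T" "\<upsilon> holomorphic_on T" "\<And>t. t \<in> T \<Longrightarrow> (\<xi> t, \<upsilon> t) \<in> W"
    and t0: "t0 \<in> T" "deriv \<xi> t0 \<noteq> 0"
  shows "(\<forall>\<^sub>F t in nhds t0.
            deriv \<xi> t * deriv (deriv \<upsilon>) t - deriv \<upsilon> t * deriv (deriv \<xi>) t =
              A (\<xi> t, \<upsilon> t) * (deriv \<xi> t) ^ 3 + B (\<xi> t, \<upsilon> t) * (deriv \<xi> t)\<^sup>2 * deriv \<upsilon> t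
              + C (\<xi> t, \<upsilon> t) * deriv \<xi> t * (deriv \<upsilon> t)\<^sup>2 + D (\<xi> t, \<upsilon> t) * (deriv \<upsilon> t) ^ 3) \<longleftrightarrow>
         (\<exists>X u. geodesic W A B C D X u \<and> \<xi> t0 \<in> X \<and> (\<forall>\<^sub>F t in nhds t0. \<upsilon> t = u (\<xi> t)))"
    (is "eventually ?E _ \<longleftrightarrow> ?G")
proof -
  let ?ode = "\<lambda>u x. deriv (deriv u) x = A (x, u x) + B (x, u x) * deriv u x + C (x, u x) * (deriv u x)\<^sup>2
                            + D (x, u x) * (deriv u x) ^ 3"
  have key: "?E t \<longleftrightarrow> ?ode u (\<xi> t)"
    if "open X" "u holomorphic_on X" "open S" "\<xi> holomorphic_on S" "\<xi> ` S \<subseteq> X"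
      "\<And>t. t \<in> S \<Longrightarrow> \<upsilon> t = u (\<xi> t)" "t \<in> S" "deriv \<xi> t \<noteq> 0" for X u S t
  proof -
    note d = deriv2_compose[OF that(1-7)]
    let ?p = "deriv u (\<xi> t)" and ?q = "deriv \<xi> t" and ?z = "(\<xi> t, u (\<xi> t))"
    have "?E t \<longleftrightarrow> deriv (deriv u) (\<xi> t) * ?q ^ 3 = (A ?z + B ?z * ?p + C ?z * ?p\<^sup>2 + D ?z * ?p ^ 3) * ?q ^ 3"
      using that(6)[OF that(7)] by (simp add: d algebra_simps power2_eq_square power3_eq_cube)
    also have "\<dots> \<longleftrightarrow> ?ode u (\<xi> t)"
      using that(8) by simp
    finally show ?thesis .
  qed
  have contd: "\<forall>\<^sub>F t in nhds t0. deriv \<xi> t \<noteq> 0"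
  proof -
    have "isCont (deriv \<xi>) t0"
      using T t0 by (metis continuous_on_eq_continuous_at holomorphic_deriv holomorphic_on_imp_continuous_on)
    then show ?thesis
      using t0(2) by (metis isCont_def tendsto_at_iff_tendsto_nhds tendsto_imp_eventually_ne)
  qed
  show ?thesis
  proof
    assume E: "eventually ?E (nhds t0)"
    obtain r where r: "r > 0" "ball t0 r \<subseteq> T" "inj_on \<xi> (ball t0 r)"
      using has_complex_derivative_locally_injective[OF T(2) t0(1) T(1) t0(2)] .
    have "\<forall>\<^sub>F t in nhds t0. ?E t \<and> deriv \<xi> t \<noteq> 0"
      using E contd by (rule eventually_conj)
    then obtain d where d: "d > 0" "\<And>t. dist t t0 < d \<Longrightarrow> ?E t \<and> deriv \<xi> t \<noteq> 0"
      unfolding eventually_nhds_metric by blast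
    let ?S = "ball t0 (min r d)"
    have sub: "?S \<subseteq> ball t0 r" by auto
    have S: "open ?S" "\<xi> holomorphic_on ?S" "\<upsilon> holomorphic_on ?S" "inj_on \<xi> ?S" "t0 \<in> ?S" "connected ?S"
      using T(2,3) r d holomorphic_on_subset[OF _ order_trans[OF sub r(2)]] inj_on_subset[OF r(3) sub] by simp_all
    have E': "?E t" "deriv \<xi> t \<noteq> 0" "(\<xi> t, \<upsilon> t) \<in> W" if "t \<in> ?S" for t
      using that d(2)[of t] subsetD[OF r(2), of t] T(4)[of t] by (simp_all add: dist_commute)
    obtain g where g: "g holomorphic_on (\<xi> ` ?S)" "\<And>t. t \<in> ?S \<Longrightarrow> g (\<xi> t) = t"
      using holomorphic_has_inverse[OF S(2,1,4)] by metis
    let ?X = "\<xi> ` ?S" and ?u = "\<upsilon> \<circ> g"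
    have X: "open ?X" "connected ?X"
      using S open_mapping_thm3[OF S(2,1,4)]
      by (auto intro: connected_continuous_image holomorphic_on_imp_continuous_on)
    have u: "?u holomorphic_on ?X"
      by (rule holomorphic_on_compose_gen[OF g(1) S(3)]) (use g(2) in auto)
    have eq: "\<upsilon> t = ?u (\<xi> t)" if "t \<in> ?S" for t
      using g(2)[OF that] by simp
    have "geodesic W A B C D ?X ?u"
      unfolding geodesic_def
    proof (intro conjI X u ballI)
      fix x assume "x \<in> ?X"
      then obtain t where t: "t \<in> ?S" "x = \<xi> t" by blast
      show "(x, ?u x) \<in> W"
        using E'(3)[OF t(1)] eq[OF t(1)] t by simp
      show "?ode ?u x"
        using key[OF X(1) u S(1,2) order_refl eq t(1) E'(2)[OF t(1)]] E'(1)[OF t(1)] unfolding t(2) by blast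
    qed
    moreover have "\<forall>\<^sub>F t in nhds t0. \<upsilon> t = ?u (\<xi> t)"
      using eventually_nhds_in_open[OF S(1,5)] by eventually_elim (rule eq)
    ultimately show ?G
      using S(5) by blast
  next
    assume ?G
    then obtain X u where X: "geodesic W A B C D X u" "\<xi> t0 \<in> X" "\<forall>\<^sub>F t in nhds t0. \<upsilon> t = u (\<xi> t)" by blast
    then have X': "open X" "u holomorphic_on X" "\<And>x. x \<in> X \<Longrightarrow> ?ode u x"
      by (auto simp: geodesic_def)
    have "isCont \<xi> t0"
      using T t0 by (metis continuous_on_eq_continuous_at holomorphic_on_imp_continuous_on)
    then have "\<forall>\<^sub>F t in nhds t0. \<xi> t \<in> X"
      using X(2) X'(1) by (metis isCont_def tendsto_at_iff_tendsto_nhds topological_tendstoD)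
    then have "\<forall>\<^sub>F t in nhds t0. t \<in> T \<and> \<xi> t \<in> X \<and> \<upsilon> t = u (\<xi> t) \<and> deriv \<xi> t \<noteq> 0"
      using X(3) contd eventually_nhds_in_open[OF T(1) t0(1)] by (intro eventually_conj)
    then obtain S where S: "open S" "t0 \<in> S"
      "\<And>t. t \<in> S \<Longrightarrow> t \<in> T \<and> \<xi> t \<in> X \<and> \<upsilon> t = u (\<xi> t) \<and> deriv \<xi> t \<noteq> 0"
      unfolding eventually_nhds by blast
    have "\<xi> holomorphic_on S" using T(2) S(3) by (auto intro: holomorphic_on_subset)
    then have "?E t" if "t \<in> S" for t
      using key[OF X'(1,2) S(1)] S(3) X'(3) that by blast
    then show "eventually ?E (nhds t0)"
      using S(1,2) unfolding eventually_nhds by blast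
  qed
qed

section \<open>Envelopes and nodal cubics\<close>

lemma vector_4 [simp]:
  "(vector [a, b, c, d] :: 'a::zero ^ 4) $ 1 = a"
  "(vector [a, b, c, d] :: 'a::zero ^ 4) $ 2 = b"
  "(vector [a, b, c, d] :: 'a::zero ^ 4) $ 3 = c"
  "(vector [a, b, c, d] :: 'a::zero ^ 4) $ 4 = d"
  by (simp_all add: vector_def)

lemma vec4_eq_iff: "x = y \<longleftrightarrow> x $ 1 = y $ 1 \<and> x $ 2 = y $ 2 \<and> x $ 3 = y $ 3 \<and> x $ 4 = y $ 4"
  for x y :: "'a ^ 4"
  by (simp add: vec_eq_iff forall_4)

lemma scalar_product_4: "scalar_product x y = x $ 1 * y $ 1 + x $ 2 * y $ 2 + x $ 3 * y $ 3 + x $ 4 * y $ 4"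
  for x y :: "'a::semiring_1 ^ 4"
  by (simp add: scalar_product_def sum_4)

lemma axis1_nth [simp]:
  "(axis 1 a :: 'a::zero ^ 4) $ 1 = a" "(axis 1 a :: 'a::zero ^ 4) $ 2 = 0"
  "(axis 1 a :: 'a::zero ^ 4) $ 3 = 0" "(axis 1 a :: 'a::zero ^ 4) $ 4 = 0"
  by (simp_all add: axis_def)

text \<open>These test vectors read off the 2 by 2 minors of a pair of covectors, and single
  coordinates when b = 0.\<close>

lemma scalar_product_axis_diff:
  fixes x :: "'a::comm_ring_1 ^ 'n"
  shows "scalar_product x (a *s axis i 1 - b *s axis j 1) = x $ i * a - x $ j * b"
proof -
  have "scalar_product x (a *s axis i 1 - b *s axis j 1)
      = (\<Sum>k\<in>UNIV. (if k = i then x $ k * a else 0) - (if k = j then x $ k * b else 0))"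
    unfolding scalar_product_def by (intro sum.cong) (auto simp: axis_def algebra_simps)
  then show ?thesis by (simp add: sum_subtractf)
qed

text \<open>Two equations of the same planes satisfy \<open>\<theta>\<^sub>i \<omega>\<^sub>j = \<theta>\<^sub>j \<omega>\<^sub>i\<close>; differentiating this shows that they
  have the same characteristic lines.\<close>

lemma envelope_planes:
  fixes \<omega> :: "complex \<Rightarrow> complex ^ 'n"
  assumes hol: "\<And>i. (\<lambda>q. \<omega> q $ i) holomorphic_on UNIV" and nz: "\<And>q. \<omega> q \<noteq> 0"
    and F: "\<And>q. F q = {w. scalar_product (\<omega> q) w = 0}"
  shows "envelope F = closure {v. \<exists>p. scalar_product (\<omega> p) v = 0 \<and> scalar_product (vderiv \<omega> p) v = 0}"
proof -
  have main: "scalar_product (\<omega> p) v = 0 \<and> scalar_product (vderiv \<omega> p) v = 0"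
    if S: "open S" "p \<in> S" and h: "\<forall>i. (\<lambda>q. \<theta> q $ i) holomorphic_on S"
      and FS: "\<forall>q\<in>S. \<theta> q \<noteq> 0 \<and> F q = {w. scalar_product (\<theta> q) w = 0}"
      and v: "scalar_product (\<theta> p) v = 0" "scalar_product (vderiv \<theta> p) v = 0"
    for p S v and \<theta> :: "complex \<Rightarrow> complex ^ 'n"
  proof -
    have ker: "scalar_product (\<omega> q) w = 0 \<longleftrightarrow> scalar_product (\<theta> q) w = 0" if "q \<in> S" for q w
      using F[of q] FS that by blast
    have \<omega>v: "scalar_product (\<omega> p) v = 0" using ker S v by blast
    obtain i where i: "\<theta> p $ i \<noteq> 0" using FS S by (metis vec_eq_iff zero_index)
    have proport: "\<theta> q $ i * \<omega> q $ j = \<theta> q $ j * \<omega> q $ i" if "q \<in> S" for q j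
    proof -
      \<comment> \<open>\<open>\<omega> q\<close> annihilates this vector, hence so does
        \<open>\<theta> q\<close>, which has the same kernel.\<close>
      have "scalar_product (\<theta> q) (\<omega> q $ j *s axis i 1 - \<omega> q $ i *s axis j 1) = 0"
        using ker[OF that] by (metis scalar_product_axis_diff mult.commute right_minus_eq)
      then show ?thesis by (simp add: scalar_product_axis_diff)
    qed
    have d\<theta>: "((\<lambda>q. \<theta> q $ j) has_field_derivative vderiv \<theta> p $ j) (at p)" for j
      using holomorphic_derivI[OF spec[OF h] S] by (simp add: vderiv_def)
    have d\<omega>: "((\<lambda>q. \<omega> q $ j) has_field_derivative vderiv \<omega> p $ j) (at p)" for j
      using hol[of j] by (simp add: vderiv_def holomorphic_derivI)
    have "\<theta> p $ i * vderiv \<omega> p $ j + vderiv \<theta> p $ i * \<omega> p $ j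
        = \<theta> p $ j * vderiv \<omega> p $ i + vderiv \<theta> p $ j * \<omega> p $ i" for j
    proof -
      have "((\<lambda>q. \<theta> q $ i * \<omega> q $ j) has_field_derivative
          \<theta> p $ j * vderiv \<omega> p $ i + vderiv \<theta> p $ j * \<omega> p $ i) (at p)"
        by (rule has_field_derivative_transform_within_open[OF DERIV_mult'[OF d\<theta> d\<omega>] S]) (simp add: proport)
      with DERIV_mult'[OF d\<theta> d\<omega>] show ?thesis by (rule DERIV_unique)
    qed
    \<comment> \<open>Contraction with \<open>v\<close>: three of the four products that result
      vanish, and \<open>\<theta> p $ i \<noteq> 0\<close> can be cancelled from the last
      one.\<close>
    then have "(\<Sum>j\<in>UNIV. (\<theta> p $ i * vderiv \<omega> p $ j + vderiv \<theta> p $ i * \<omega> p $ j) * v $ j)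
        = (\<Sum>j\<in>UNIV. (\<theta> p $ j * vderiv \<omega> p $ i + vderiv \<theta> p $ j * \<omega> p $ i) * v $ j)"
      by simp
    then have "\<theta> p $ i * scalar_product (vderiv \<omega> p) v + vderiv \<theta> p $ i * scalar_product (\<omega> p) v
        = vderiv \<omega> p $ i * scalar_product (\<theta> p) v + \<omega> p $ i * scalar_product (vderiv \<theta> p) v"
      by (simp add: scalar_product_def sum.distrib sum_distrib_left algebra_simps)
    with v \<omega>v i show ?thesis by simp
  qed
  have "{v. \<exists>p \<theta> S. open S \<and> p \<in> S \<and> (\<forall>i. (\<lambda>q. \<theta> q $ i) holomorphic_on S) \<and>
     (\<forall>q\<in>S. \<theta> q \<noteq> 0 \<and> F q = {w. scalar_product (\<theta> q) w = 0}) \<and>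
     scalar_product (\<theta> p) v = 0 \<and> scalar_product (vderiv \<theta> p) v = 0}
    = {v. \<exists>p. scalar_product (\<omega> p) v = 0 \<and> scalar_product (vderiv \<omega> p) v = 0}" (is "?L = ?R")
  proof
    show "?L \<subseteq> ?R" using main by blast
    show "?R \<subseteq> ?L"
    proof
      fix v assume "v \<in> ?R"
      then obtain p where "scalar_product (\<omega> p) v = 0 \<and> scalar_product (vderiv \<omega> p) v = 0" by blast
      then show "v \<in> ?L"
        using hol nz F by (intro CollectI exI[of _ p] exI[of _ \<omega>] exI[of _ UNIV]) auto
    qed
  qed
  then show ?thesis
    unfolding envelope_def by simp
qed

text \<open>With \<open>R\<close> an inverse frame, \<open>f q v* R\<close> are ambient covectors;
  \<open>R\<close> does not depend on the parameter, so characteristic lines may be computed in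
  local coordinates.\<close>

lemma vderiv_vector_matrix_mult:
  fixes f :: "complex \<Rightarrow> complex ^ 'm" and R :: "complex ^ 'n ^ 'm"
  assumes "\<And>i. (\<lambda>q. f q $ i) field_differentiable at p"
  shows "vderiv (\<lambda>q. f q v* R) p = vderiv f p v* R"
proof -
  have "((\<lambda>q. f q $ i) has_field_derivative vderiv f p $ i) (at p)" for i
    using assms by (simp add: vderiv_def DERIV_deriv_iff_field_differentiable)
  then have "((\<lambda>q. \<Sum>i\<in>UNIV. R $ i $ j * f q $ i) has_field_derivative (\<Sum>i\<in>UNIV. R $ i $ j * vderiv f p $ i)) (at p)" for j
    by (intro DERIV_sum DERIV_cmult)
  then have "deriv (\<lambda>q. \<Sum>i\<in>UNIV. R $ i $ j * f q $ i) p = (\<Sum>i\<in>UNIV. R $ i $ j * vderiv f p $ i)" for j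
    by (rule DERIV_imp_deriv)
  then show ?thesis
    by (simp add: vec_eq_iff vderiv_def vector_matrix_mult_def mult.commute)
qed

lemma scalar_product_vector_matrix: "scalar_product (x v* R) w = scalar_product x (R *v w)"
  for R :: "'a::comm_semiring_1 ^ 'n ^ 'm"
  unfolding scalar_product_def vector_matrix_mult_def matrix_vector_mult_def
  by (simp add: sum_distrib_left sum_distrib_right mult_ac) (rule sum.swap)

text \<open>\<open>osc_coords\<close> is the rational parametrization, by the slope of the geodesic, of a nodal cubic in the
  plane coordinates \<open>(0, U\<^sub>2, U\<^sub>3, U\<^sub>4)\<close>, and \<open>char_point p\<close> spans together with \<open>axis 1 1\<close> the
  characteristic line of the plane \<open>osc_coords p\<close>; it is their cross product with the derivative.\<close>

definition osc_coords :: "complex \<Rightarrow> complex \<Rightarrow> complex \<Rightarrow> complex \<Rightarrow> complex \<Rightarrow> complex ^ 4" where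
  "osc_coords K0 K1 K2 K3 p = vector [0, - 2 * p\<^sup>2, 2 * p, - (K0 + K1 * p + K2 * p\<^sup>2 + K3 * p ^ 3)]"

definition char_point :: "complex \<Rightarrow> complex \<Rightarrow> complex \<Rightarrow> complex \<Rightarrow> complex \<Rightarrow> complex ^ 4" where
  "char_point K0 K1 K2 K3 p =
     vector [0, 2 * K0 - 2 * K2 * p\<^sup>2 - 4 * K3 * p ^ 3, 4 * K0 * p + 2 * K1 * p\<^sup>2 - 2 * K3 * p ^ 4, 4 * p\<^sup>2]"

lemma vderiv_osc_coords:
  "vderiv (osc_coords K0 K1 K2 K3) p = vector [0, - 4 * p, 2, - (K1 + 2 * K2 * p + 3 * K3 * p\<^sup>2)]"
  unfolding vec4_eq_iff vderiv_def osc_coords_def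
  by (auto intro!: DERIV_imp_deriv derivative_eq_intros)

lemma osc_coords_holomorphic: "(\<lambda>p. osc_coords K0 K1 K2 K3 p $ i) holomorphic_on S"
proof -
  have "\<forall>i. (\<lambda>p. osc_coords K0 K1 K2 K3 p $ i) holomorphic_on S"
    by (auto simp: forall_4 osc_coords_def intro!: holomorphic_intros)
  then show ?thesis by blast
qed

text \<open>The coordinate 2 p vanishes only at p = 0, where the last one is - K0.\<close>

lemma osc_coords_nonzero: "K0 \<noteq> 0 \<Longrightarrow> osc_coords K0 K1 K2 K3 p \<noteq> 0"
  by (auto simp: vec4_eq_iff osc_coords_def)

text \<open>Two linear equations that leave the first coordinate free. The multiple of
  \<open>char_point\<close> is fixed by the fourth coordinate for p \<noteq> 0 and by the second for
  p = 0.\<close>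

lemma characteristic_line:
  assumes "K0 \<noteq> 0"
  shows "scalar_product (osc_coords K0 K1 K2 K3 p) \<eta> = 0 \<and>
         scalar_product (vderiv (osc_coords K0 K1 K2 K3) p) \<eta> = 0 \<longleftrightarrow>
         (\<exists>r s. \<eta> = r *s axis 1 1 + s *s char_point K0 K1 K2 K3 p)" (is "?L \<longleftrightarrow> ?R")
proof
  assume ?L
  then have 1: "- 2 * p\<^sup>2 * \<eta> $ 2 + 2 * p * \<eta> $ 3 = (K0 + K1 * p + K2 * p\<^sup>2 + K3 * p ^ 3) * \<eta> $ 4"
    and 2: "2 * \<eta> $ 3 = 4 * p * \<eta> $ 2 + (K1 + 2 * K2 * p + 3 * K3 * p\<^sup>2) * \<eta> $ 4"
    unfolding scalar_product_4 vderiv_osc_coords osc_coords_def by (simp, algebra)+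
  show ?R
  proof (cases "p = 0")
    case True
    with 1 2 assms have "\<eta> $ 4 = 0" "\<eta> $ 3 = 0" by auto
    with True assms show ?thesis
      by (intro exI[of _ "\<eta> $ 1"] exI[of _ "\<eta> $ 2 / (2 * K0)"]) (simp add: vec4_eq_iff char_point_def)
  next
    case False
    have "4 * p\<^sup>2 * \<eta> $ 2 = (2 * K0 - 2 * K2 * p\<^sup>2 - 4 * K3 * p ^ 3) * \<eta> $ 4"
      using 1 2 by algebra
    then have "\<eta> $ 2 = \<eta> $ 4 / (4 * p\<^sup>2) * (2 * K0 - 2 * K2 * p\<^sup>2 - 4 * K3 * p ^ 3)"
      using False by (simp add: field_simps)
    moreover have "\<eta> $ 3 = \<eta> $ 4 / (4 * p\<^sup>2) * (4 * K0 * p + 2 * K1 * p\<^sup>2 - 2 * K3 * p ^ 4)"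
    proof -
      have "4 * p\<^sup>2 * \<eta> $ 3 = (4 * K0 * p + 2 * K1 * p\<^sup>2 - 2 * K3 * p ^ 4) * \<eta> $ 4"
        using 1 2 by algebra
      then show ?thesis using False by (simp add: field_simps)
    qed
    ultimately show ?thesis
      using False by (intro exI[of _ "\<eta> $ 1"] exI[of _ "\<eta> $ 4 / (4 * p\<^sup>2)"]) (simp add: vec4_eq_iff char_point_def)
  qed
next
  assume ?R
  then obtain r s where \<eta>: "\<eta> = r *s axis 1 1 + s *s char_point K0 K1 K2 K3 p" by blast
  show ?L
    unfolding \<eta> scalar_product_4 vderiv_osc_coords osc_coords_def char_point_def
    by (simp add: algebra_simps power2_eq_square power3_eq_cube power4_eq_xxxx)
qed

section \<open>The cubic in plane coordinates and its gradient\<close>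

lemma plane_gradient_contact_cubic:
  "plane_gradient (contact_cubic k k0 k1 k2 k3) U =
     vector [0, k * U $ 3 * U $ 4 + 3 * k0 * (U $ 2)\<^sup>2 + 2 * k1 * U $ 2 * U $ 3 + k2 * (U $ 3)\<^sup>2,
       k * U $ 2 * U $ 4 + k1 * (U $ 2)\<^sup>2 + 2 * k2 * U $ 2 * U $ 3 + 3 * k3 * (U $ 3)\<^sup>2, k * U $ 2 * U $ 3]"
  unfolding vec4_eq_iff plane_gradient_def contact_cubic_def
  by (auto intro!: DERIV_imp_deriv derivative_eq_intros simp: axis_def)

text \<open>The contact cubic with k = 2 \<kappa>, where \<kappa> carries the free factor of the
  equation: 1 for \<open>cone_cubic\<close>, k / 2 in the converse.\<close>

abbreviation nodal_cubic :: "complex \<Rightarrow> complex \<Rightarrow> complex \<Rightarrow> complex \<Rightarrow> complex \<Rightarrow> complex ^ 4 \<Rightarrow> complex" where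
  "nodal_cubic \<kappa> K0 K1 K2 K3 \<equiv> contact_cubic (\<kappa> * 2) (\<kappa> * K3) (- (\<kappa> * K2)) (\<kappa> * K1) (- (\<kappa> * K0))"

text \<open>A general line through the node U2 = U3 = 0 meets the cubic in one further point,
  labelled by p = - U2 / U3; the node itself belongs to p = 0. \<open>K3 \<noteq> 0\<close> and
  \<open>K0 \<noteq> 0\<close> exclude solutions where exactly one of U2, U3 vanishes.\<close>

lemma nodal_cubic_zero_iff:
  assumes K: "K0 \<noteq> 0" "K3 \<noteq> 0" and \<kappa>: "\<kappa> \<noteq> 0"
  shows "U $ 1 = 0 \<and> nodal_cubic \<kappa> K0 K1 K2 K3 U = 0 \<longleftrightarrow> (\<exists>t p. U = t *s osc_coords K0 K1 K2 K3 p)"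
proof
  assume U: "U $ 1 = 0 \<and> nodal_cubic \<kappa> K0 K1 K2 K3 U = 0"
  then have "\<kappa> * (2 * U $ 2 * U $ 3 * U $ 4 + K3 * (U $ 2) ^ 3 - K2 * (U $ 2)\<^sup>2 * U $ 3
      + K1 * U $ 2 * (U $ 3)\<^sup>2 - K0 * (U $ 3) ^ 3) = 0"
    by (simp add: contact_cubic_def algebra_simps)
  then have eq: "2 * U $ 2 * U $ 3 * U $ 4 + K3 * (U $ 2) ^ 3 - K2 * (U $ 2)\<^sup>2 * U $ 3
      + K1 * U $ 2 * (U $ 3)\<^sup>2 - K0 * (U $ 3) ^ 3 = 0"
    using \<kappa> by simp
  show "\<exists>t p. U = t *s osc_coords K0 K1 K2 K3 p"
  proof (cases "U $ 3 = 0")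
    case True
    with eq K have "U $ 2 = 0" by simp
    with True U K show ?thesis
      by (intro exI[of _ "- U $ 4 / K0"] exI[of _ 0]) (simp add: vec4_eq_iff osc_coords_def)
  next
    case False
    define p where "p = - U $ 2 / U $ 3"
    have U2: "U $ 2 = - p * U $ 3" using False by (simp add: p_def)
    have "p \<noteq> 0" using eq False K by (auto simp: U2)
    have "(2 * p * U $ 4) * (U $ 3)\<^sup>2 = - (K0 + K1 * p + K2 * p\<^sup>2 + K3 * p ^ 3) * U $ 3 * (U $ 3)\<^sup>2"
      using eq unfolding U2 by algebra
    then have "2 * p * U $ 4 = - (K0 + K1 * p + K2 * p\<^sup>2 + K3 * p ^ 3) * U $ 3"
      using False by simp
    then have "U $ 4 = U $ 3 / (2 * p) * - (K0 + K1 * p + K2 * p\<^sup>2 + K3 * p ^ 3)"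
      using \<open>p \<noteq> 0\<close> by (simp add: field_simps)
    then show ?thesis
      using U \<open>p \<noteq> 0\<close> U2
      by (intro exI[of _ "U $ 3 / (2 * p)"] exI[of _ p])
        (simp add: vec4_eq_iff osc_coords_def power2_eq_square)
  qed
next
  assume "\<exists>t p. U = t *s osc_coords K0 K1 K2 K3 p"
  then show "U $ 1 = 0 \<and> nodal_cubic \<kappa> K0 K1 K2 K3 U = 0"
    by (auto simp: contact_cubic_def osc_coords_def algebra_simps power2_eq_square power3_eq_cube)
qed

text \<open>In the factor, t^2 reflects that the gradient is quadratic, and p that it vanishes at
  the node.\<close>

lemma plane_gradient_osc_coords:
  "plane_gradient (nodal_cubic \<kappa> K0 K1 K2 K3) (t *s osc_coords K0 K1 K2 K3 p) =
     (- 2 * \<kappa> * t\<^sup>2 * p) *s char_point K0 K1 K2 K3 p"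
  unfolding plane_gradient_contact_cubic vec4_eq_iff
  by (simp add: osc_coords_def char_point_def algebra_simps power2_eq_square power3_eq_cube power4_eq_xxxx)

text \<open>\<open>tangential_cone\<close> admits the planes with nonzero gradient, which on the
  parametrization excludes p = 0; division by the factor of \<open>plane_gradient_osc_coords\<close>
  identifies the lines.\<close>

lemma gradient_lines:
  assumes K: "K0 \<noteq> 0" "K3 \<noteq> 0" and \<kappa>: "\<kappa> \<noteq> 0"
    and G_def: "G = nodal_cubic \<kappa> K0 K1 K2 K3"
  shows "{r *s axis 1 1 + s *s plane_gradient G U |r s U. U $ 1 = 0 \<and> G U = 0 \<and> plane_gradient G U \<noteq> 0}
    = {r *s axis 1 1 + s *s char_point K0 K1 K2 K3 p |r s p. p \<noteq> 0}" (is "?L = ?R")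
proof (intro subset_antisym subsetI)
  fix \<eta> assume "\<eta> \<in> ?L"
  then obtain r s U where \<eta>: "\<eta> = r *s axis 1 1 + s *s plane_gradient G U" and U: "U $ 1 = 0 \<and> G U = 0"
    and g: "plane_gradient G U \<noteq> 0" by blast
  obtain t p where tp: "U = t *s osc_coords K0 K1 K2 K3 p"
    using U nodal_cubic_zero_iff[OF K \<kappa>] unfolding G_def by blast
  have grad: "plane_gradient G U = (- 2 * \<kappa> * t\<^sup>2 * p) *s char_point K0 K1 K2 K3 p"
    unfolding G_def tp by (rule plane_gradient_osc_coords)
  with g have "p \<noteq> 0" by auto
  moreover have "\<eta> = r *s axis 1 1 + (s * (- 2 * \<kappa> * t\<^sup>2 * p)) *s char_point K0 K1 K2 K3 p"
    unfolding \<eta> grad by (simp add: vector_smult_assoc)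
  ultimately show "\<eta> \<in> ?R" by blast
next
  fix \<eta> assume "\<eta> \<in> ?R"
  then obtain r s p where \<eta>: "\<eta> = r *s axis 1 1 + s *s char_point K0 K1 K2 K3 p" and p: "p \<noteq> 0" by blast
  let ?U = "osc_coords K0 K1 K2 K3 p"
  have U: "?U $ 1 = 0 \<and> G ?U = 0"
    using nodal_cubic_zero_iff[OF K \<kappa>, of ?U] unfolding G_def by (metis vector_smult_lid)
  have grad: "plane_gradient G ?U = (- 2 * \<kappa> * p) *s char_point K0 K1 K2 K3 p"
    using plane_gradient_osc_coords[where t = 1] unfolding G_def by simp
  have "plane_gradient G ?U $ 4 \<noteq> 0"
    using p \<kappa> by (simp add: grad char_point_def)
  then have "plane_gradient G ?U \<noteq> 0" by auto
  moreover have "\<eta> = r *s axis 1 1 + (s / (- 2 * \<kappa> * p)) *s plane_gradient G ?U"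
    unfolding \<eta> grad using p \<kappa> by (simp add: vector_smult_assoc)
  ultimately show "\<eta> \<in> ?L" using U by blast
qed

section \<open>Limiting characteristic lines and the section by the tangent plane\<close>

lemma continuous_on_vec4:
  fixes f :: "'a::topological_space \<Rightarrow> complex ^ 4"
  assumes "continuous_on S (\<lambda>t. f t $ 1)" "continuous_on S (\<lambda>t. f t $ 2)"
    "continuous_on S (\<lambda>t. f t $ 3)" "continuous_on S (\<lambda>t. f t $ 4)"
  shows "continuous_on S f"
proof -
  have "\<forall>i. continuous_on S (\<lambda>t. f t $ i)" using assms by (simp add: forall_4)
  then have "continuous_on S (\<lambda>t. \<chi> i. f t $ i)" by (intro continuous_on_vec_lambda) auto
  then show ?thesis by simp
qed

lemma limit_in_closure:
  fixes f :: "complex \<Rightarrow> 'a::topological_space"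
  assumes "continuous_on UNIV f" "\<And>t. t \<noteq> 0 \<Longrightarrow> f t \<in> T"
  shows "f 0 \<in> closure T"
proof -
  have "closure (- {0 :: complex}) = UNIV"
    by (simp add: closure_complement)
  then have "f ` closure (- {0}) \<subseteq> closure T"
    using assms by (intro image_closure_subset) (auto intro: closure_subset[THEN subsetD])
  with \<open>closure (- {0}) = UNIV\<close> show ?thesis by auto
qed

text \<open>The envelope runs over all slopes, while the tangential cone omits the node p = 0. The
  line of p = 0 is a limit of the others, so the closures agree.\<close>

lemma closure_characteristic_lines:
  "closure {r *s axis 1 1 + s *s char_point K0 K1 K2 K3 p |r s p. True}
    = closure {r *s axis 1 1 + s *s char_point K0 K1 K2 K3 p |r s p. p \<noteq> 0}" (is "closure ?E = closure ?T")
proof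
  show "closure ?T \<subseteq> closure ?E" by (rule closure_mono) blast
  have "r *s axis 1 1 + s *s char_point K0 K1 K2 K3 p \<in> closure ?T" for r s p
  proof (cases "p = 0")
    case True
    have "continuous_on UNIV (\<lambda>p. r *s axis 1 1 + s *s char_point K0 K1 K2 K3 p)"
      by (rule continuous_on_vec4) (auto simp: char_point_def intro!: continuous_intros)
    from limit_in_closure[OF this, of ?T] True show ?thesis by blast
  next
    case False
    then show ?thesis by (intro closure_subset[THEN subsetD]) blast
  qed
  then have "?E \<subseteq> closure ?T" by blast
  then show "closure ?E \<subseteq> closure ?T" by (simp add: closure_minimal)
qed

text \<open>In points, the cone is a quartic, given by the polynomial \<open>Q\<close> below, which is \<open>\<eta>\<^sub>2\<^sup>2 \<eta>\<^sub>3\<^sup>2\<close> on the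
  tangent plane \<open>\<eta>\<^sub>4 = 0\<close>. Conversely, the two lines are limits of characteristic lines for
  \<open>p \<rightarrow> 0\<close> and \<open>p = 1 / t \<rightarrow> \<infinity>\<close>.\<close>

lemma cone_meets_tangent_plane:
  assumes K: "K0 \<noteq> 0" "K3 \<noteq> 0"
    and T_def: "T = {r *s axis 1 1 + s *s char_point K0 K1 K2 K3 p |r s p. p \<noteq> 0}"
  shows "closure T \<inter> {\<eta>. \<eta> $ 4 = 0} = {\<eta>. \<eta> $ 3 = 0 \<and> \<eta> $ 4 = 0} \<union> {\<eta>. \<eta> $ 2 = 0 \<and> \<eta> $ 4 = 0}"
proof (intro subset_antisym subsetI)
  fix \<eta> assume \<eta>: "\<eta> \<in> closure T \<inter> {\<eta>. \<eta> $ 4 = 0}"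
  \<comment> \<open>A point \<eta> lies on the plane of slope p iff K3 Z p^3 + 2 X p^2 - 2 Y p + K0
    Z = 0; the shifts in \<open>X\<close> and \<open>Y\<close> absorb K1 and K2. \<open>Q\<close> is
    the discriminant of this cubic in p divided by 16: on its characteristic line p is a double
    root.\<close>
  define Q where "Q = (\<lambda>\<eta> :: complex ^ 4. let X = \<eta> $ 2 + K2 / 2 * \<eta> $ 4; Y = \<eta> $ 3 - K1 / 2 * \<eta> $ 4; Z = \<eta> $ 4 in
    X\<^sup>2 * Y\<^sup>2 - 2 * K0 * X ^ 3 * Z + 2 * K3 * Y ^ 3 * Z - 9 / 2 * K0 * K3 * X * Y * Z\<^sup>2 - 27 / 16 * K0\<^sup>2 * K3\<^sup>2 * Z ^ 4)"
  have "Q (r *s axis 1 1 + s *s char_point K0 K1 K2 K3 p) = 0" for r s p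
  proof -
    \<comment> \<open>With m = K0 and n = K3 p^3 the powers of s and p factor out of
      \<open>Q\<close>, and this homogeneous identity in two variables is what remains.\<close>
    have id: "(m - 2 * n)\<^sup>2 * (2 * m - n)\<^sup>2 - 4 * m * (m - 2 * n) ^ 3 + 4 * n * (2 * m - n) ^ 3
        - 18 * m * n * (m - 2 * n) * (2 * m - n) - 27 * m\<^sup>2 * n\<^sup>2 = 0" for m n :: complex
      by algebra
    define m n where "m = K0" and "n = K3 * p ^ 3"
    have X: "s * (2 * K0 - 4 * K3 * p ^ 3) = 2 * s * (m - 2 * n)"
      and Y: "s * (4 * K0 * p - 2 * K3 * p ^ 4) = 2 * s * p * (2 * m - n)"
      by (simp_all add: m_def n_def algebra_simps power3_eq_cube power4_eq_xxxx)
    have "(2 * s * e)\<^sup>2 * (2 * s * p * f)\<^sup>2 - 2 * K0 * (2 * s * e) ^ 3 * (s * (4 * p\<^sup>2))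
        + 2 * K3 * (2 * s * p * f) ^ 3 * (s * (4 * p\<^sup>2))
        - 9 / 2 * K0 * K3 * (2 * s * e) * (2 * s * p * f) * (s * (4 * p\<^sup>2))\<^sup>2
        - 27 / 16 * K0\<^sup>2 * K3\<^sup>2 * (s * (4 * p\<^sup>2)) ^ 4
      = 16 * s ^ 4 * p\<^sup>2 * (e\<^sup>2 * f\<^sup>2 - 4 * m * e ^ 3 + 4 * n * f ^ 3 - 18 * m * n * e * f - 27 * m\<^sup>2 * n\<^sup>2)" for e f
      unfolding m_def n_def
      by (simp add: algebra_simps power2_eq_square power3_eq_cube power4_eq_xxxx)
    also note id
    finally have "(s * (2 * K0 - 4 * K3 * p ^ 3))\<^sup>2 * (s * (4 * K0 * p - 2 * K3 * p ^ 4))\<^sup>2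
        - 2 * K0 * (s * (2 * K0 - 4 * K3 * p ^ 3)) ^ 3 * (s * (4 * p\<^sup>2))
        + 2 * K3 * (s * (4 * K0 * p - 2 * K3 * p ^ 4)) ^ 3 * (s * (4 * p\<^sup>2))
        - 9 / 2 * K0 * K3 * (s * (2 * K0 - 4 * K3 * p ^ 3)) * (s * (4 * K0 * p - 2 * K3 * p ^ 4)) * (s * (4 * p\<^sup>2))\<^sup>2
        - 27 / 16 * K0\<^sup>2 * K3\<^sup>2 * (s * (4 * p\<^sup>2)) ^ 4 = 0"
      unfolding X Y mult_zero_right .
    moreover have "s * (2 * K0 - 2 * K2 * p\<^sup>2 - 4 * K3 * p ^ 3) + K2 / 2 * (s * (4 * p\<^sup>2)) = s * (2 * K0 - 4 * K3 * p ^ 3)"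
      "s * (4 * K0 * p + 2 * K1 * p\<^sup>2 - 2 * K3 * p ^ 4) - K1 / 2 * (s * (4 * p\<^sup>2)) = s * (4 * K0 * p - 2 * K3 * p ^ 4)"
      by (simp_all add: algebra_simps)
    ultimately show ?thesis
      by (simp only: Q_def char_point_def Let_def vector_4 vector_add_component vector_smult_component
          axis1_nth mult_zero_right add_0)
  qed
  then have "T \<subseteq> {\<eta>. Q \<eta> = 0}" by (auto simp: T_def)
  moreover have "closed {\<eta>. Q \<eta> = 0}"
    unfolding Q_def Let_def by (intro closed_Collect_eq continuous_intros)
  ultimately have "closure T \<subseteq> {\<eta>. Q \<eta> = 0}" by (rule closure_minimal)
  with \<eta> show "\<eta> \<in> {\<eta>. \<eta> $ 3 = 0 \<and> \<eta> $ 4 = 0} \<union> {\<eta>. \<eta> $ 2 = 0 \<and> \<eta> $ 4 = 0}"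
    by (auto simp: Q_def)
next
  fix \<eta> :: "complex ^ 4"
  assume "\<eta> \<in> {\<eta>. \<eta> $ 3 = 0 \<and> \<eta> $ 4 = 0} \<union> {\<eta>. \<eta> $ 2 = 0 \<and> \<eta> $ 4 = 0}"
  then consider "\<eta> $ 3 = 0" "\<eta> $ 4 = 0" | "\<eta> $ 2 = 0" "\<eta> $ 4 = 0" by blast
  then show "\<eta> \<in> closure T \<inter> {\<eta>. \<eta> $ 4 = 0}"
  proof cases
    case 1
    \<comment> \<open>\<open>char_point\<close> at p = 0 is 2 K0 times the second axis.\<close>
    have "\<eta> = \<eta> $ 1 *s axis 1 1 + (\<eta> $ 2 / (2 * K0)) *s char_point K0 K1 K2 K3 0"
      using 1 K by (simp add: vec4_eq_iff char_point_def)
    then have "\<eta> \<in> {r *s axis 1 1 + s *s char_point K0 K1 K2 K3 p |r s p. True}" by blast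
    then have "\<eta> \<in> closure T"
      unfolding T_def closure_characteristic_lines[symmetric] by (rule closure_subset[THEN subsetD])
    with 1 show ?thesis by simp
  next
    case 2
    \<comment> \<open>The generator at slope 1 / t is multiplied by t^4 to become polynomial in t;
      at t = 0 it is - 2 K3 times the third axis, whence the factor - \<eta>3 / (2 K3).\<close>
    define f :: "complex \<Rightarrow> complex ^ 4" where "f t = vector [\<eta> $ 1, - \<eta> $ 3 / (2 * K3) * (2 * K0 * t ^ 4 - 2 * K2 * t\<^sup>2 - 4 * K3 * t),
      - \<eta> $ 3 / (2 * K3) * (4 * K0 * t ^ 3 + 2 * K1 * t\<^sup>2 - 2 * K3), - \<eta> $ 3 / (2 * K3) * (4 * t\<^sup>2)]" for t
    have "f 0 \<in> closure T"
    proof (rule limit_in_closure)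
      show "continuous_on UNIV f"
        using K by (intro continuous_on_vec4) (auto simp: f_def intro!: continuous_intros)
      fix t :: complex assume t: "t \<noteq> 0"
      have "f t = \<eta> $ 1 *s axis 1 1 + (- \<eta> $ 3 / (2 * K3) * t ^ 4) *s char_point K0 K1 K2 K3 (1 / t)"
      proof -
        have "t ^ 4 * (2 * K0 - 2 * K2 * (1 / t)\<^sup>2 - 4 * K3 * (1 / t) ^ 3) = 2 * K0 * t ^ 4 - 2 * K2 * t\<^sup>2 - 4 * K3 * t"
          "t ^ 4 * (4 * K0 * (1 / t) + 2 * K1 * (1 / t)\<^sup>2 - 2 * K3 * (1 / t) ^ 4) = 4 * K0 * t ^ 3 + 2 * K1 * t\<^sup>2 - 2 * K3"
          "t ^ 4 * (4 * (1 / t)\<^sup>2) = 4 * t\<^sup>2"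
          using t by (simp_all add: field_simps power2_eq_square power3_eq_cube power4_eq_xxxx)
        then show ?thesis
          by (simp only: vec4_eq_iff f_def char_point_def vector_4 vector_add_component vector_smult_component
              axis1_nth mult.assoc) simp
      qed
      moreover have "1 / t \<noteq> 0" using t by simp
      ultimately show "f t \<in> T" unfolding T_def by blast
    qed
    moreover have "f 0 = \<eta>" using 2 K by (simp add: vec4_eq_iff f_def)
    ultimately show ?thesis using 2 by simp
  qed
qed

section \<open>Surfaces referred to their asymptotic curves\<close>

lemma Dx_nth: "Dx f z $ i = pdx (\<lambda>z. f z $ i) z"
  and Du_nth: "Du f z $ i = pdu (\<lambda>z. f z $ i) z"
  by (simp_all add: Dx_def Du_def vderiv_def pdx_def pdu_def)

lemma span_pair: "vec.span {u, v} = {i *s u + j *s v |i j. True}" for u v :: "complex ^ 'n"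
  by (auto simp: vec.span_insert algebra_simps eq_diff_eq)

lemma span_triple: "vec.span {u, v, w} = {i *s u + j *s v + k *s w |i j k. True}" for u v w :: "complex ^ 'n"
proof -
  have "x \<in> vec.span {u, v, w} \<longleftrightarrow> (\<exists>i j k. x - i *s u = j *s v + k *s w)" for x
    unfolding vec.span_insert[of u] span_pair by blast
  then show ?thesis
    by (auto simp: diff_eq_eq ac_simps)
qed

text \<open>The columns are y, y_x, y_u, y_xu, so that the passage to local coordinates becomes
  matrix inversion and Cramer's rule.\<close>

definition frame :: "(complex \<times> complex \<Rightarrow> complex ^ 4) \<Rightarrow> complex \<times> complex \<Rightarrow> complex ^ 4 ^ 4" where
  "frame y z = (\<chi> i j. local_point y z (axis j 1) $ i)"

lemma local_point_eq_frame: "local_point y z \<eta> = frame y z *v \<eta>"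
proof -
  have "local_point y z \<eta> $ i = (frame y z *v \<eta>) $ i" for i
    by (simp add: matrix_vector_mult_def frame_def sum_4 local_point_def axis_def)
  then show ?thesis by (simp add: vec_eq_iff)
qed

lemma local_point_add: "local_point y z (\<eta> + \<zeta>) = local_point y z \<eta> + local_point y z \<zeta>"
  and local_point_smult: "local_point y z (k *s \<eta>) = k *s local_point y z \<eta>"
  by (simp_all add: local_point_eq_frame matrix_vector_right_distrib vector_scalar_commute)

text \<open>Real linearity is what lets an injective \<open>local_point\<close> commute with
  closures.\<close>

lemma linear_local_point: "linear (local_point y z)"
proof (rule linearI)
  fix r :: real and \<eta> :: "complex ^ 4"
  have "r *\<^sub>R \<zeta> = complex_of_real r *s \<zeta>" for \<zeta> :: "complex ^ 4"
    by (simp add: vec_eq_iff) (simp add: scaleR_conv_of_real)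
  then show "local_point y z (r *\<^sub>R \<eta>) = r *\<^sub>R local_point y z \<eta>"
    by (simp add: local_point_smult)
qed (rule local_point_add)

text \<open>The geometric hypotheses enter through \<open>form_M_nonzero\<close>, the linear
  independence of y, y_x, y_u, y_xu, which L = 0 (asymptotic net) and LN - M^2 \<noteq> 0
  imply.\<close>

locale asymptotic_surface =
  fixes W :: "(complex \<times> complex) set" and y :: "complex \<times> complex \<Rightarrow> complex ^ 4"
    and a b c a1 b1 c1 :: "complex \<times> complex \<Rightarrow> complex"
  assumes open_W: "open W" and y_hol: "\<And>i. holomorphic2_on (\<lambda>z. y z $ i) W"
    and form_M_nonzero: "\<And>z. z \<in> W \<Longrightarrow> form_M y z \<noteq> 0"
    and eq_xx: "\<And>z. z \<in> W \<Longrightarrow> Dx (Dx y) z + c z *s y z + (2 * a z) *s Dx y z + (2 * b z) *s Du y z = 0"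
    and eq_uu: "\<And>z. z \<in> W \<Longrightarrow> Du (Du y) z + c1 z *s y z + (2 * a1 z) *s Dx y z + (2 * b1 z) *s Du y z = 0"
begin

section \<open>Derivatives of the surface in the local frame\<close>

lemma Dx_hol: "holomorphic2_on (\<lambda>z. Dx y z $ i) W"
  and Du_hol: "holomorphic2_on (\<lambda>z. Du y z $ i) W"
  by (simp_all add: Dx_nth Du_nth holomorphic2_intros open_W y_hol)

lemma Dxx_hol: "holomorphic2_on (\<lambda>z. Dx (Dx y) z $ i) W"
  and Dux_hol: "holomorphic2_on (\<lambda>z. Du (Dx y) z $ i) W"
  and Duu_hol: "holomorphic2_on (\<lambda>z. Du (Du y) z $ i) W"
  by (simp_all add: Dx_nth[of "Dx y"] Du_nth[of "Dx y"] Du_nth[of "Du y"] holomorphic2_intros open_W Dx_hol Du_hol)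

lemma Dx_Du: "z \<in> W \<Longrightarrow> Dx (Du y) z = Du (Dx y) z"
  using pdx_pdu_commute[OF open_W] y_hol
  by (simp add: vec_eq_iff Dx_nth Du_nth holomorphic2_iff_sep[OF open_W])

lemma inj_local_point:
  assumes z: "z \<in> W"
  shows "inj (local_point y z)"
proof -
  have "\<eta> = 0" if "local_point y z \<eta> = 0" for \<eta>
  proof -
    \<comment> \<open>The rows in \<open>form_M\<close> begin with y_xu, so the fourth local
      coordinate comes first in the vector.\<close>
    let ?M = "vector [Du (Dx y) z, y z, Dx y z, Du y z] :: complex ^ 4 ^ 4"
    have "vector [\<eta> $ 4, \<eta> $ 1, \<eta> $ 2, \<eta> $ 3] v* ?M = local_point y z \<eta>"
      by (simp add: vec_eq_iff vector_matrix_mult_def sum_4 local_point_def)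
    then have "transpose ?M *v vector [\<eta> $ 4, \<eta> $ 1, \<eta> $ 2, \<eta> $ 3] = 0"
      using that by simp
    moreover have "invertible (transpose ?M)"
      using form_M_nonzero[OF z] by (simp add: invertible_det_nz form_M_def)
    then obtain B where "B ** transpose ?M = mat 1"
      unfolding invertible_def by blast
    ultimately have "(vector [\<eta> $ 4, \<eta> $ 1, \<eta> $ 2, \<eta> $ 3] :: complex ^ 4) = 0"
      using matrix_vector_mul_assoc[of B "transpose ?M" "vector [\<eta> $ 4, \<eta> $ 1, \<eta> $ 2, \<eta> $ 3]"]
      by (simp del: transpose_matrix_vector)
    then show ?thesis
      by (simp add: vec4_eq_iff)
  qed
  then show ?thesis
    using linear_injective_0[OF linear_local_point] by blast
qed

lemma invertible_frame:
  assumes z: "z \<in> W"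
  shows "invertible (frame y z)"
proof -
  have "inj ((*v) (frame y z))"
    using inj_local_point[OF z] by (simp add: inj_def local_point_eq_frame)
  then show ?thesis
    by (simp add: invertible_left_inverse matrix_left_invertible_injective)
qed

lemma frame_inverse:
  assumes z: "z \<in> W"
  obtains R where "\<And>\<eta>. R *v local_point y z \<eta> = \<eta>" "\<And>w. local_point y z (R *v w) = w"
proof -
  obtain R where "R ** frame y z = mat 1" "frame y z ** R = mat 1"
    using invertible_frame[OF z] unfolding invertible_def by blast
  then show thesis
    using that[of R] by (simp add: local_point_eq_frame matrix_vector_mul_assoc)
qed

lemma frame_hol: "holomorphic2_on (\<lambda>z. frame y z $ i $ j) W"
  unfolding frame_def local_point_def
  by (simp add: holomorphic2_intros open_W y_hol Dx_hol Du_hol Dux_hol)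

text \<open>Cramer's rule exhibits local coordinates as quotients of determinants of holomorphic
  functions.\<close>

lemma local_coordinate_hol:
  assumes h: "\<And>i. holomorphic2_on (\<lambda>z. h z $ i) W"
    and eq: "\<And>z. z \<in> W \<Longrightarrow> h z = local_point y z (\<eta> z)"
  shows "holomorphic2_on (\<lambda>z. \<eta> z $ k) W"
proof -
  have det: "det (frame y z) \<noteq> 0" if "z \<in> W" for z
    using invertible_frame[OF that] by (simp add: invertible_det_nz)
  let ?N = "\<lambda>z. det (\<chi> i j. if j = k then h z $ i else frame y z $ i $ j)"
  have "holomorphic2_on (\<lambda>z. (\<chi> i j. if j = k then h z $ i else frame y z $ i $ j) $ i $ j) W" for i j
    by (cases "j = k") (simp_all add: h frame_hol)
  then have "holomorphic2_on (\<lambda>z. ?N z / det (frame y z)) W"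
    using det by (intro holomorphic2_on_divide holomorphic2_on_det open_W frame_hol)
  moreover have "\<eta> z $ k = ?N z / det (frame y z)" if "z \<in> W" for z
    using cramer[OF det[OF that], of "\<eta> z" "h z"] eq[OF that] local_point_eq_frame by simp
  ultimately show ?thesis
    by (simp cong: holomorphic2_on_cong)
qed

lemma Dxx_local:
  assumes "z \<in> W"
  shows "Dx (Dx y) z = local_point y z (vector [- c z, - 2 * a z, - 2 * b z, 0])"
proof -
  have "Dx (Dx y) z $ i = - c z * y z $ i - 2 * a z * Dx y z $ i - 2 * b z * Du y z $ i" for i
  proof -
    have "Dx (Dx y) z $ i + c z * y z $ i + 2 * a z * Dx y z $ i + 2 * b z * Du y z $ i = 0"
      using arg_cong[OF eq_xx[OF assms], of "\<lambda>v. v $ i"] by simp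
    then show ?thesis by algebra
  qed
  then show ?thesis
    by (simp add: vec_eq_iff local_point_def)
qed

lemma Duu_local:
  assumes "z \<in> W"
  shows "Du (Du y) z = local_point y z (vector [- c1 z, - 2 * a1 z, - 2 * b1 z, 0])"
proof -
  have "Du (Du y) z $ i = - c1 z * y z $ i - 2 * a1 z * Dx y z $ i - 2 * b1 z * Du y z $ i" for i
  proof -
    have "Du (Du y) z $ i + c1 z * y z $ i + 2 * a1 z * Dx y z $ i + 2 * b1 z * Du y z $ i = 0"
      using arg_cong[OF eq_uu[OF assms], of "\<lambda>v. v $ i"] by simp
    then show ?thesis by algebra
  qed
  then show ?thesis
    by (simp add: vec_eq_iff local_point_def)
qed

text \<open>Up to the factor - 2 these are local coordinates of y_xx and y_uu, hence determined by
  y. Their holomorphy makes A, B, C, D holomorphic in the converse.\<close>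

lemma coefficients_hol:
  "holomorphic2_on a W" "holomorphic2_on b W" "holomorphic2_on a1 W" "holomorphic2_on b1 W"
proof -
  have half: "holomorphic2_on f W" if "holomorphic2_on (\<lambda>z. - 2 * f z) W" for f
  proof -
    have "holomorphic2_on (\<lambda>z. (- 1 / 2) * (- 2 * f z)) W"
      by (intro holomorphic2_intros open_W that)
    then show ?thesis by simp
  qed
  show "holomorphic2_on a W" "holomorphic2_on b W"
    using local_coordinate_hol[OF Dxx_hol Dxx_local, of 2] local_coordinate_hol[OF Dxx_hol Dxx_local, of 3]
    by (auto intro: half)
  show "holomorphic2_on a1 W" "holomorphic2_on b1 W"
    using local_coordinate_hol[OF Duu_hol Duu_local, of 2] local_coordinate_hol[OF Duu_hol Duu_local, of 3]
    by (auto intro: half)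
qed

section \<open>Tangent plane and asymptotic tangents in local coordinates\<close>

lemma tangent_plane_local: "tangent_plane y z = local_point y z ` {\<eta>. \<eta> $ 4 = 0}"
proof (intro subset_antisym subsetI)
  fix v assume "v \<in> tangent_plane y z"
  then obtain i j k where "v = i *s y z + j *s Dx y z + k *s Du y z"
    unfolding tangent_plane_def span_triple by blast
  then show "v \<in> local_point y z ` {\<eta>. \<eta> $ 4 = 0}"
    by (intro image_eqI[of _ _ "vector [i, j, k, 0]"]) (simp_all add: local_point_def)
next
  fix v assume "v \<in> local_point y z ` {\<eta>. \<eta> $ 4 = 0}"
  then show "v \<in> tangent_plane y z"
    unfolding tangent_plane_def span_triple by (auto simp: local_point_def)
qed

lemma asymptotic_tangent_x_local: "asymptotic_tangent_x y z = local_point y z ` {\<eta>. \<eta> $ 3 = 0 \<and> \<eta> $ 4 = 0}"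
proof (intro subset_antisym subsetI)
  fix v assume "v \<in> asymptotic_tangent_x y z"
  then obtain i j where "v = i *s y z + j *s Dx y z"
    unfolding asymptotic_tangent_x_def span_pair by blast
  then show "v \<in> local_point y z ` {\<eta>. \<eta> $ 3 = 0 \<and> \<eta> $ 4 = 0}"
    by (intro image_eqI[of _ _ "vector [i, j, 0, 0]"]) (simp_all add: local_point_def)
next
  fix v assume "v \<in> local_point y z ` {\<eta>. \<eta> $ 3 = 0 \<and> \<eta> $ 4 = 0}"
  then show "v \<in> asymptotic_tangent_x y z"
    unfolding asymptotic_tangent_x_def span_pair by (auto simp: local_point_def)
qed

lemma asymptotic_tangent_u_local: "asymptotic_tangent_u y z = local_point y z ` {\<eta>. \<eta> $ 2 = 0 \<and> \<eta> $ 4 = 0}"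
proof (intro subset_antisym subsetI)
  fix v assume "v \<in> asymptotic_tangent_u y z"
  then obtain i j where "v = i *s y z + j *s Du y z"
    unfolding asymptotic_tangent_u_def span_pair by blast
  then show "v \<in> local_point y z ` {\<eta>. \<eta> $ 2 = 0 \<and> \<eta> $ 4 = 0}"
    by (intro image_eqI[of _ _ "vector [i, 0, j, 0]"]) (simp_all add: local_point_def)
next
  fix v assume "v \<in> local_point y z ` {\<eta>. \<eta> $ 2 = 0 \<and> \<eta> $ 4 = 0}"
  then show "v \<in> asymptotic_tangent_u y z"
    unfolding asymptotic_tangent_u_def span_pair by (auto simp: local_point_def)
qed

section \<open>Osculating planes of curves on the surface\<close>

lemma curve_derivatives:
  assumes X: "open X" "u holomorphic_on X" "\<And>x. x \<in> X \<Longrightarrow> (x, u x) \<in> W" and x: "x \<in> X"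
  defines "Y \<equiv> \<lambda>s. y (s, u s)" and "z \<equiv> (x, u x)"
  shows "vderiv Y x = Dx y z + deriv u x *s Du y z"
    and "vderiv (vderiv Y) x = Dx (Dx y) z + (2 * deriv u x) *s Du (Dx y) z
           + (deriv u x)\<^sup>2 *s Du (Du y) z + deriv (deriv u) x *s Du y z"
proof -
  have du: "(u has_field_derivative deriv u s) (at s)" if "s \<in> X" for s
    using X that by (auto intro: holomorphic_derivI)
  have ddu: "(deriv u has_field_derivative deriv (deriv u) x) (at x)"
    using X x by (auto intro: holomorphic_derivI holomorphic_deriv)
  have chain: "((\<lambda>s. f (s, u s)) has_field_derivative pdx f (s, u s) + pdu f (s, u s) * deriv u s) (at s)"
    if "holomorphic2_on f W" "s \<in> X" for f s
    using holomorphic2_chain[OF open_W that(1), of "\<lambda>s. s" s u 1 "deriv u s"] X(3)[OF that(2)] du[OF that(2)] by simp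
  have 1: "vderiv Y s = Dx y (s, u s) + deriv u s *s Du y (s, u s)" if "s \<in> X" for s
    using DERIV_imp_deriv[OF chain[OF y_hol that]]
    by (simp add: vec_eq_iff vderiv_def Y_def Dx_nth Du_nth mult.commute)
  then show "vderiv Y x = Dx y z + deriv u x *s Du y z"
    using x by (simp add: z_def)
  have "((\<lambda>s. vderiv Y s $ i) has_field_derivative
      pdx (\<lambda>z. Dx y z $ i) z + pdu (\<lambda>z. Dx y z $ i) z * deriv u x
      + (deriv (deriv u) x * Du y z $ i + (pdx (\<lambda>z. Du y z $ i) z + pdu (\<lambda>z. Du y z $ i) z * deriv u x) * deriv u x)) (at x)" for i
  proof (rule has_field_derivative_transform_within_open[OF _ X(1) x])
    show "((\<lambda>s. Dx y (s, u s) $ i + deriv u s * Du y (s, u s) $ i) has_field_derivative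
      pdx (\<lambda>z. Dx y z $ i) z + pdu (\<lambda>z. Dx y z $ i) z * deriv u x
      + (deriv (deriv u) x * Du y z $ i + (pdx (\<lambda>z. Du y z $ i) z + pdu (\<lambda>z. Du y z $ i) z * deriv u x) * deriv u x)) (at x)"
      unfolding z_def
      by (rule DERIV_add[OF chain[OF Dx_hol x] DERIV_mult[OF ddu chain[OF Du_hol x]]])
    show "Dx y (s, u s) $ i + deriv u s * Du y (s, u s) $ i = vderiv Y s $ i" if "s \<in> X" for s
      by (simp add: 1[OF that])
  qed
  then have "vderiv (vderiv Y) x $ i =
      Dx (Dx y) z $ i + Du (Dx y) z $ i * deriv u x
      + (deriv (deriv u) x * Du y z $ i + (Dx (Du y) z $ i + Du (Du y) z $ i * deriv u x) * deriv u x)" for i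
    unfolding vderiv_def[of "vderiv Y"] Dx_nth[of "Dx y"] Du_nth[of "Dx y"] Dx_nth[of "Du y"] Du_nth[of "Du y"]
    by (simp add: DERIV_imp_deriv)
  \<comment> \<open>Equality of the mixed derivatives produces the coefficient 2 u' of y_xu.\<close>
  moreover have "Dx (Du y) z = Du (Dx y) z"
    using X(3)[OF x] by (simp add: Dx_Du z_def)
  ultimately show "vderiv (vderiv Y) x = Dx (Dx y) z + (2 * deriv u x) *s Du (Dx y) z
           + (deriv u x)\<^sup>2 *s Du (Du y) z + deriv (deriv u) x *s Du y z"
    by (simp add: vec_eq_iff algebra_simps power2_eq_square)
qed

text \<open>The plane coordinates are minors of \<open>?v\<close> and \<open>?w\<close>; inserting
  y_xx, y_uu and the geodesic equation makes t3 - p t2 the cubic in p. At p = 0 the hypothesis says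
  t3 \<noteq> 0, so that y, y', y'' still span a plane.\<close>

lemma osculating_plane_local:
  assumes g: "geodesic_through W A B C D P X u" and K0: "A P - 2 * b P \<noteq> 0"
  shows "osculating_plane y u (fst P) = local_plane y P
    (osc_coords (A P - 2 * b P) (B P + 2 * a P) (C P - 2 * b1 P) (D P + 2 * a1 P) (deriv u (fst P)))"
proof -
  let ?x = "fst P"
  define p where "p = deriv u ?x"
  define q where "q = A P + B P * p + C P * p\<^sup>2 + D P * p ^ 3"
  have X: "open X" "u holomorphic_on X" "\<And>x. x \<in> X \<Longrightarrow> (x, u x) \<in> W" "?x \<in> X" and Pu: "(?x, u ?x) = P"
    and ode: "deriv (deriv u) ?x = q"
    using g by (auto simp: geodesic_through_def geodesic_def q_def p_def)
  have P: "P \<in> W" using X(3)[OF X(4)] Pu by simp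
  define t2 where "t2 = - 2 * a P - 2 * a1 P * p\<^sup>2"
  define t3 where "t3 = - 2 * b P - 2 * b1 P * p\<^sup>2 + q"
  let ?e = "axis 1 1 :: complex ^ 4" and ?v = "vector [0, 1, p, 0] :: complex ^ 4"
    and ?w = "vector [- c P - c1 P * p\<^sup>2, t2, t3, 2 * p] :: complex ^ 4"
  let ?\<omega> = "osc_coords (A P - 2 * b P) (B P + 2 * a P) (C P - 2 * b1 P) (D P + 2 * a1 P) p"
  have d1: "vderiv (\<lambda>s. y (s, u s)) ?x = Dx y P + p *s Du y P"
    using curve_derivatives(1)[OF X] by (simp only: Pu p_def)
  have d2: "vderiv (vderiv (\<lambda>s. y (s, u s))) ?x
      = Dx (Dx y) P + (2 * p) *s Du (Dx y) P + p\<^sup>2 *s Du (Du y) P + q *s Du y P"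
    using curve_derivatives(2)[OF X] by (simp only: Pu p_def ode)
  have 0: "y (?x, u ?x) = local_point y P ?e"
    by (simp add: Pu local_point_def)
  have 1: "vderiv (\<lambda>s. y (s, u s)) ?x = local_point y P ?v"
    by (simp add: d1 local_point_def)
  have 2: "vderiv (vderiv (\<lambda>s. y (s, u s))) ?x = local_point y P ?w"
    unfolding d2 Dxx_local[OF P] Duu_local[OF P]
    by (simp add: local_point_def vec_eq_iff t2_def t3_def algebra_simps)
  have "osculating_plane y u ?x = {local_point y P (i *s ?e + j *s ?v + k *s ?w) |i j k. True}"
    unfolding osculating_plane_def Let_def span_triple 0 1 2 by (simp only: local_point_add local_point_smult)
  also have "\<dots> = local_plane y P ?\<omega>"
  proof -
    have iff: "(\<exists>i j k. \<eta> = i *s ?e + j *s ?v + k *s ?w) \<longleftrightarrow> scalar_product ?\<omega> \<eta> = 0" for \<eta>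
    proof
      assume "\<exists>i j k. \<eta> = i *s ?e + j *s ?v + k *s ?w"
      then show "scalar_product ?\<omega> \<eta> = 0"
        by (auto simp: scalar_product_4 osc_coords_def t2_def t3_def q_def algebra_simps power2_eq_square power3_eq_cube)
    next
      assume s: "scalar_product ?\<omega> \<eta> = 0"
      show "\<exists>i j k. \<eta> = i *s ?e + j *s ?v + k *s ?w"
      proof (cases "p = 0")
        case True
        with s K0 have "\<eta> $ 4 = 0" by (simp add: scalar_product_4 osc_coords_def)
        moreover have t: "t3 \<noteq> 0" using True K0 by (simp add: t3_def q_def)
        ultimately show ?thesis using True
          by (intro exI[of _ "\<eta> $ 1 - \<eta> $ 3 / t3 * (- c P - c1 P * p\<^sup>2)"] exI[of _ "\<eta> $ 2 - \<eta> $ 3 / t3 * t2"]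
              exI[of _ "\<eta> $ 3 / t3"]) (simp add: vec4_eq_iff)
      next
        case False
        have eq: "2 * p * \<eta> $ 3 = 2 * p * p * \<eta> $ 2 + (t3 - p * t2) * \<eta> $ 4"
          using s unfolding scalar_product_4 osc_coords_def t2_def t3_def q_def
          by (simp add: algebra_simps power2_eq_square power3_eq_cube)
        \<comment> \<open>The multiple of \<open>?w\<close> is forced by the fourth coordinate,
          which is 2 p in \<open>?w\<close> and zero in the other two vectors.\<close>
        define k where "k = \<eta> $ 4 / (2 * p)"
        have \<eta>4: "\<eta> $ 4 = k * (2 * p)" using False by (simp add: k_def)
        have "2 * p * \<eta> $ 3 = 2 * p * ((\<eta> $ 2 - k * t2) * p + k * t3)"
          using eq unfolding \<eta>4 by algebra
        then have "\<eta> $ 3 = (\<eta> $ 2 - k * t2) * p + k * t3"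
          using False by simp
        then have "\<eta> = (\<eta> $ 1 - k * (- c P - c1 P * p\<^sup>2)) *s ?e + (\<eta> $ 2 - k * t2) *s ?v + k *s ?w"
          using \<eta>4 by (simp add: vec4_eq_iff left_diff_distrib)
        then show ?thesis by blast
      qed
    qed
    have "{local_point y P (i *s ?e + j *s ?v + k *s ?w) |i j k. True}
      = {local_point y P \<eta> |\<eta>. \<exists>i j k. \<eta> = i *s ?e + j *s ?v + k *s ?w}" by blast
    then show ?thesis unfolding iff local_plane_def .
  qed
  finally show ?thesis by (simp add: p_def)
qed

lemma tangential_cone_local:
  assumes K: "K0 \<noteq> 0" "K3 \<noteq> 0" and \<kappa>: "\<kappa> \<noteq> 0" and P: "P \<in> W"
  shows "tangential_cone y P (nodal_cubic \<kappa> K0 K1 K2 K3) =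
    local_point y P ` closure {r *s axis 1 1 + s *s char_point K0 K1 K2 K3 p |r s p. p \<noteq> 0}"
proof -
  let ?G = "nodal_cubic \<kappa> K0 K1 K2 K3"
  have "{local_point y P (r *s axis 1 1 + s *s plane_gradient ?G U) |r s U.
      U $ 1 = 0 \<and> ?G U = 0 \<and> plane_gradient ?G U \<noteq> 0}
    = local_point y P ` {r *s axis 1 1 + s *s plane_gradient ?G U |r s U.
      U $ 1 = 0 \<and> ?G U = 0 \<and> plane_gradient ?G U \<noteq> 0}" by blast
  then show ?thesis
    unfolding tangential_cone_def
    by (simp add: gradient_lines[OF K \<kappa> refl] closure_injective_linear_image[OF linear_local_point inj_local_point[OF P]])
qed

text \<open>Gives local planes an equation in the ambient space, as \<open>envelope\<close>
  demands.\<close>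

lemma local_plane_eq:
  assumes "\<And>\<eta>. R *v local_point y z \<eta> = \<eta>" "\<And>w. local_point y z (R *v w) = w"
  shows "local_plane y z U = {w. scalar_product (U v* R) w = 0}"
  unfolding local_plane_def scalar_product_vector_matrix using assms by (auto intro: exI[of _ "R *v _"])

lemma envelope_local:
  assumes K0: "K0 \<noteq> 0" and P: "P \<in> W"
  shows "envelope (\<lambda>p. local_plane y P (osc_coords K0 K1 K2 K3 p)) =
    local_point y P ` closure {r *s axis 1 1 + s *s char_point K0 K1 K2 K3 p |r s p. True}"
proof -
  obtain R where R: "\<And>\<eta>. R *v local_point y P \<eta> = \<eta>" "\<And>w. local_point y P (R *v w) = w"
    by (rule frame_inverse[OF P]) (rule that)
  let ?\<omega> = "osc_coords K0 K1 K2 K3"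
  have fd: "(\<lambda>q. ?\<omega> q $ i) field_differentiable at p" for i p
    using osc_coords_holomorphic[of K0 K1 K2 K3 i UNIV] holomorphic_on_imp_differentiable_at by blast
  have "envelope (\<lambda>p. local_plane y P (?\<omega> p)) = closure {v. \<exists>p. scalar_product (?\<omega> p v* R) v = 0 \<and>
      scalar_product (vderiv (\<lambda>p. ?\<omega> p v* R) p) v = 0}"
  proof (rule envelope_planes)
    show "(\<lambda>q. (?\<omega> q v* R) $ i) holomorphic_on UNIV" for i
      unfolding vector_matrix_mult_def
      by (auto intro!: holomorphic_intros osc_coords_holomorphic)
    show "?\<omega> q v* R \<noteq> 0" for q
    proof
      assume "?\<omega> q v* R = 0"
      then have "scalar_product (?\<omega> q) (R *v w) = 0" for w
        unfolding scalar_product_vector_matrix[symmetric] by (simp add: scalar_product_def)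
      \<comment> \<open>\<open>R\<close> is onto, so \<open>?\<omega> q\<close> would annihilate
        every vector.\<close>
      then have "scalar_product (?\<omega> q) \<eta> = 0" for \<eta>
        using R(1) by metis
      then have "?\<omega> q $ i = 0" for i
        using scalar_product_axis_diff[of "?\<omega> q" 1 i 0 i] by simp
      then show False using osc_coords_nonzero[OF K0] by (metis vec_eq_iff zero_index)
    qed
    show "local_plane y P (?\<omega> q) = {w. scalar_product (?\<omega> q v* R) w = 0}" for q
      by (rule local_plane_eq[OF R])
  qed
  also have "{v. \<exists>p. scalar_product (?\<omega> p v* R) v = 0 \<and> scalar_product (vderiv (\<lambda>p. ?\<omega> p v* R) p) v = 0}
    = {v. \<exists>p r s. R *v v = r *s axis 1 1 + s *s char_point K0 K1 K2 K3 p}"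
    unfolding vderiv_vector_matrix_mult[OF fd] scalar_product_vector_matrix characteristic_line[OF K0] ..
  also have "\<dots> = local_point y P ` {r *s axis 1 1 + s *s char_point K0 K1 K2 K3 p |r s p. True}"
  proof (intro subset_antisym subsetI)
    fix v assume "v \<in> {v. \<exists>p r s. R *v v = r *s axis 1 1 + s *s char_point K0 K1 K2 K3 p}"
    then have "R *v v \<in> {r *s axis 1 1 + s *s char_point K0 K1 K2 K3 p |r s p. True}" by blast
    then have "local_point y P (R *v v) \<in> local_point y P ` {r *s axis 1 1 + s *s char_point K0 K1 K2 K3 p |r s p. True}"
      by (rule imageI)
    then show "v \<in> local_point y P ` {r *s axis 1 1 + s *s char_point K0 K1 K2 K3 p |r s p. True}"
      by (simp only: R(2))
  next
    fix v assume "v \<in> local_point y P ` {r *s axis 1 1 + s *s char_point K0 K1 K2 K3 p |r s p. True}"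
    then show "v \<in> {v. \<exists>p r s. R *v v = r *s axis 1 1 + s *s char_point K0 K1 K2 K3 p}"
      using R(1) by blast
  qed
  also have "closure \<dots> = local_point y P ` closure {r *s axis 1 1 + s *s char_point K0 K1 K2 K3 p |r s p. True}"
    by (rule closure_injective_linear_image[OF linear_local_point inj_local_point[OF P], symmetric])
  finally show ?thesis .
qed

lemma local_plane_smult: "t \<noteq> 0 \<Longrightarrow> local_plane y z (t *s U) = local_plane y z U"
  by (simp add: local_plane_def scalar_product_def mult.assoc sum_distrib_left[symmetric])

text \<open>Every slope is attained by a geodesic, so the osculating planes exhaust the family of
  \<open>osc_coords\<close>, which by \<open>nodal_cubic_zero_iff\<close> is the zero set of the
  cubic up to scaling.\<close>

lemma osculating_planes_envelop_nodal_cubic: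
  assumes ABCD: "holomorphic2_on A W" "holomorphic2_on B W" "holomorphic2_on C W" "holomorphic2_on D W"
    and P: "P \<in> W" and K: "A P - 2 * b P \<noteq> 0" "D P + 2 * a1 P \<noteq> 0" and \<kappa>: "\<kappa> \<noteq> 0"
  shows "osculating_planes_envelop W y A B C D P
    (nodal_cubic \<kappa> (A P - 2 * b P) (B P + 2 * a P) (C P - 2 * b1 P) (D P + 2 * a1 P))"
    (is "osculating_planes_envelop W y A B C D P ?G")
proof -
  let ?\<omega> = "osc_coords (A P - 2 * b P) (B P + 2 * a P) (C P - 2 * b1 P) (D P + 2 * a1 P)"
  have ex: "\<exists>X u. geodesic_through W A B C D P X u \<and> deriv u (fst P) = p" for p
    using geodesics_one_parameter_holomorphic[OF open_W ABCD P] unfolding geodesics_one_parameter_def by blast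
  have planes: "{osculating_plane y u (fst P) |X u. geodesic_through W A B C D P X u} = {local_plane y P (?\<omega> p) |p. True}"
  proof -
    have "osculating_plane y u (fst P) = local_plane y P (?\<omega> (deriv u (fst P)))"
      if "geodesic_through W A B C D P X u" for X u
      using that K(1) by (rule osculating_plane_local)
    then show ?thesis using ex by (auto; metis)
  qed
  also have "\<dots> = {local_plane y P U |U. U \<noteq> 0 \<and> U $ 1 = 0 \<and> ?G U = 0}"
  proof (intro subset_antisym subsetI)
    fix F assume "F \<in> {local_plane y P (?\<omega> p) |p. True}"
    then obtain p where F: "F = local_plane y P (?\<omega> p)" by blast
    have "?\<omega> p $ 1 = 0 \<and> ?G (?\<omega> p) = 0"
      using nodal_cubic_zero_iff[OF K \<kappa>, of "?\<omega> p"] by (metis vector_smult_lid)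
    then show "F \<in> {local_plane y P U |U. U \<noteq> 0 \<and> U $ 1 = 0 \<and> ?G U = 0}"
      unfolding F using osc_coords_nonzero[OF K(1)] by blast
  next
    fix F assume "F \<in> {local_plane y P U |U. U \<noteq> 0 \<and> U $ 1 = 0 \<and> ?G U = 0}"
    then obtain U where U: "F = local_plane y P U" "U \<noteq> 0" "U $ 1 = 0 \<and> ?G U = 0" by blast
    then obtain t p where tp: "U = t *s ?\<omega> p"
      using nodal_cubic_zero_iff[OF K \<kappa>] by blast
    with U have "t \<noteq> 0" by auto
    with U tp have "F = local_plane y P (?\<omega> p)" by (simp add: local_plane_smult)
    then show "F \<in> {local_plane y P (?\<omega> p) |p. True}" by blast
  qed
  finally have set_eq: "{osculating_plane y u (fst P) |X u. geodesic_through W A B C D P X u}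
    = {local_plane y P U |U. U \<noteq> 0 \<and> U $ 1 = 0 \<and> ?G U = 0}" .
  show ?thesis
    unfolding osculating_planes_envelop_def
  proof (intro conjI exI[of _ "\<lambda>p. local_plane y P (?\<omega> p)"] allI impI set_eq)
    show "osculating_plane y u (fst P) = local_plane y P (?\<omega> (deriv u (fst P)))"
      if "geodesic_through W A B C D P X u" for X u
      using that K(1) by (rule osculating_plane_local)
    show "envelope (\<lambda>p. local_plane y P (?\<omega> p)) = tangential_cone y P ?G"
      unfolding envelope_local[OF K(1) P] tangential_cone_local[OF K \<kappa> P] closure_characteristic_lines ..
  qed
qed

lemma cone_inter_tangent_plane:
  assumes P: "P \<in> W" and K: "K0 \<noteq> 0" "K3 \<noteq> 0" and \<kappa>: "\<kappa> \<noteq> 0"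
  shows "tangential_cone y P (nodal_cubic \<kappa> K0 K1 K2 K3) \<inter> tangent_plane y P
    = asymptotic_tangent_x y P \<union> asymptotic_tangent_u y P"
  unfolding tangential_cone_local[OF K \<kappa> P] tangent_plane_local asymptotic_tangent_x_local asymptotic_tangent_u_local
    image_Int[OF inj_local_point[OF P], symmetric] image_Un[symmetric] cone_meets_tangent_plane[OF K refl] ..

end

text \<open>\<open>cone_cubic\<close> is written for u'' = \<delta> + 3 \<gamma> u' + 3 \<beta> u'^2
  + \<alpha> u'^3, hence the reversed order of A, B, C, D and the thirds.\<close>

lemma cone_cubic_nodal:
  "cone_cubic a b a1 b1 D (C / 3) (B / 3) A = nodal_cubic 1 (A - 2 * b) (B + 2 * a) (C - 2 * b1) (D + 2 * a1)"
  by (rule ext) (simp add: cone_cubic_def contact_cubic_def algebra_simps)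

text \<open>The equation is linear in U4 with coefficient 2 U2 U3, so each pair of nonzero values U2
  = r, U3 = t extends to a zero of the first cubic. The second vanishes there too, and the binary
  cubics in (r, t) agree; the common coefficient 2 fixes the scale.\<close>

lemma nodal_cubic_zero_set_inj:
  assumes "{U. nodal_cubic 1 K0 K1 K2 K3 U = 0} = {U. nodal_cubic 1 L0 L1 L2 L3 U = 0}"
  shows "K0 = L0 \<and> K1 = L1 \<and> K2 = L2 \<and> K3 = L3"
proof -
  have eq: "K3 * r ^ 3 - K2 * r\<^sup>2 * t + K1 * r * t\<^sup>2 - K0 * t ^ 3 = L3 * r ^ 3 - L2 * r\<^sup>2 * t + L1 * r * t\<^sup>2 - L0 * t ^ 3"
    if "r \<noteq> 0" "t \<noteq> 0" for r t
  proof -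
    define q where "q = K3 * r ^ 3 - K2 * r\<^sup>2 * t + K1 * r * t\<^sup>2 - K0 * t ^ 3"
    let ?U = "vector [0, r, t, - q / (2 * r * t)] :: complex ^ 4"
    have q: "2 * r * t * (- q / (2 * r * t)) = - q" using that by simp
    have gen: "nodal_cubic 1 M0 M1 M2 M3 (vector [0, r, t, X]) =
        2 * r * t * X + (M3 * r ^ 3 - M2 * r\<^sup>2 * t + M1 * r * t\<^sup>2 - M0 * t ^ 3)" for M0 M1 M2 M3 X
      by (simp add: contact_cubic_def)
    have "?U \<in> {U. nodal_cubic 1 K0 K1 K2 K3 U = 0}"
      unfolding mem_Collect_eq gen q q_def[symmetric] by simp
    then have "nodal_cubic 1 L0 L1 L2 L3 ?U = 0" using assms by blast
    then have "L3 * r ^ 3 - L2 * r\<^sup>2 * t + L1 * r * t\<^sup>2 - L0 * t ^ 3 = q"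
      unfolding gen q by simp
    then show ?thesis by (simp add: q_def)
  qed
  \<comment> \<open>The values at four points with distinct ratios determine a binary cubic.\<close>
  have "K3 - L3 = 0 \<and> K2 - L2 = 0 \<and> K1 - L1 = 0 \<and> K0 - L0 = 0"
    using eq[of 1 1] eq[of 1 "-1"] eq[of 2 1] eq[of 1 2] by (simp add: algebra_simps) algebra
  then show ?thesis by simp
qed

theorem theorem2p8:
  fixes W :: "(complex \<times> complex) set"
    and y :: "complex \<times> complex \<Rightarrow> complex ^ 4"
    and a b c a1 b1 c1 :: "complex \<times> complex \<Rightarrow> complex"
  assumes "surface W y"
    and "nondevelopable W y"
    and "asymptotic_net W y"
    and "\<And>z. z \<in> W \<Longrightarrow> Dx (Dx y) z + c z *s y z + (2 * a z) *s Dx y z + (2 * b z) *s Du y z = 0"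
    and "\<And>z. z \<in> W \<Longrightarrow> Du (Du y) z + c1 z *s y z + (2 * a1 z) *s Dx y z + (2 * b1 z) *s Du y z = 0"
  shows
    "(\<forall>A B C D P. (\<forall>f\<in>{A, B, C, D}. holomorphic2_on f W) \<and> P \<in> W \<longrightarrow>
        geodesics_one_parameter W A B C D P \<and>
        (D P + 2 * a1 P \<noteq> 0 \<and> A P - 2 * b P \<noteq> 0 \<longrightarrow>
          (let G = cone_cubic (a P) (b P) (a1 P) (b1 P) (D P) (C P / 3) (B P / 3) (A P) in
             osculating_planes_envelop W y A B C D P G \<and>
             tangential_cone y P G \<inter> tangent_plane y P
               = asymptotic_tangent_x y P \<union> asymptotic_tangent_u y P))) \<and>
     (\<forall>k k0 k1 k2 k3. (\<forall>f\<in>{k, k0, k1, k2, k3}. holomorphic2_on f W) \<and> (\<forall>z\<in>W. k z \<noteq> 0) \<longrightarrow>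
        (\<exists>A B C D. (\<forall>f\<in>{A, B, C, D}. holomorphic2_on f W) \<and>
           (\<forall>z\<in>W. {U. contact_cubic (k z) (k0 z) (k1 z) (k2 z) (k3 z) U = 0} =
              {U. cone_cubic (a z) (b z) (a1 z) (b1 z) (D z) (C z / 3) (B z / 3) (A z) U = 0}) \<and>
           (\<forall>z\<in>W. k0 z \<noteq> 0 \<and> k3 z \<noteq> 0 \<longrightarrow>
              osculating_planes_envelop W y A B C D z
                (contact_cubic (k z) (k0 z) (k1 z) (k2 z) (k3 z))) \<and>
           (\<forall>A' B' C' D'.
              (\<forall>z\<in>W. {U. contact_cubic (k z) (k0 z) (k1 z) (k2 z) (k3 z) U = 0} =
                 {U. cone_cubic (a z) (b z) (a1 z) (b1 z) (D' z) (C' z / 3) (B' z / 3) (A' z) U = 0}) \<longrightarrow>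
              (\<forall>z\<in>W. A' z = A z \<and> B' z = B z \<and> C' z = C z \<and> D' z = D z)))) \<and>
     (\<forall>A B C D \<xi> \<upsilon> T t0. (\<forall>f\<in>{A, B, C, D}. holomorphic2_on f W) \<and>
        open T \<and> \<xi> holomorphic_on T \<and> \<upsilon> holomorphic_on T \<and> (\<forall>t\<in>T. (\<xi> t, \<upsilon> t) \<in> W) \<and>
        t0 \<in> T \<and> deriv \<xi> t0 \<noteq> 0 \<longrightarrow>
        ((\<forall>\<^sub>F t in nhds t0.
            deriv \<xi> t * deriv (deriv \<upsilon>) t - deriv \<upsilon> t * deriv (deriv \<xi>) t =
              A (\<xi> t, \<upsilon> t) * (deriv \<xi> t) ^ 3 + B (\<xi> t, \<upsilon> t) * (deriv \<xi> t)\<^sup>2 * deriv \<upsilon> t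
              + C (\<xi> t, \<upsilon> t) * deriv \<xi> t * (deriv \<upsilon> t)\<^sup>2 + D (\<xi> t, \<upsilon> t) * (deriv \<upsilon> t) ^ 3) \<longleftrightarrow>
         (\<exists>X u. geodesic W A B C D X u \<and> \<xi> t0 \<in> X \<and> (\<forall>\<^sub>F t in nhds t0. \<upsilon> t = u (\<xi> t)))))"
proof -
  have W: "open W" and y_hol: "\<And>i. holomorphic2_on (\<lambda>z. y z $ i) W"
    using assms(1) by (auto simp: surface_def)
  interpret asymptotic_surface W y a b c a1 b1 c1
  proof
    fix z assume z: "z \<in> W"
    show "form_M y z \<noteq> 0"
    proof
      assume "form_M y z = 0"
      \<comment> \<open>That dx = 1, du = 0 is asymptotic says L = 0; with M = 0 the expression LN -
        M^2 would vanish.\<close>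
      moreover have "asymptotic_direction y z 1 0"
        using assms(3) z by (simp add: asymptotic_net_def)
      ultimately show False
        using assms(2) z by (auto simp: asymptotic_direction_def nondevelopable_def)
    qed
  qed (use W y_hol assms(4,5) in auto)
  have envelop: "osculating_planes_envelop W y A B C D P G"
    if "\<forall>f\<in>{A, B, C, D}. holomorphic2_on f W" "P \<in> W" "D P + 2 * a1 P \<noteq> 0" "A P - 2 * b P \<noteq> 0" "\<kappa> \<noteq> 0"
      "G = nodal_cubic \<kappa> (A P - 2 * b P) (B P + 2 * a P) (C P - 2 * b1 P) (D P + 2 * a1 P)" for A B C D P \<kappa> G
    unfolding that(6) using that(1) by (intro osculating_planes_envelop_nodal_cubic that) auto
  show ?thesis
  proof (intro conjI[OF _ conjI] allI impI, goal_cases)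
    case (1 A B C D P)
    let ?G = "cone_cubic (a P) (b P) (a1 P) (b1 P) (D P) (C P / 3) (B P / 3) (A P)"
    show ?case
    proof (intro conjI impI)
      show "geodesics_one_parameter W A B C D P"
        using 1 by (intro geodesics_one_parameter_holomorphic W) auto
      assume K: "D P + 2 * a1 P \<noteq> 0 \<and> A P - 2 * b P \<noteq> 0"
      have "osculating_planes_envelop W y A B C D P ?G"
        using 1 K by (intro envelop[where \<kappa> = 1] cone_cubic_nodal) auto
      moreover have "tangential_cone y P ?G \<inter> tangent_plane y P = asymptotic_tangent_x y P \<union> asymptotic_tangent_u y P"
        unfolding cone_cubic_nodal using 1 K by (intro cone_inter_tangent_plane) auto
      ultimately show "let G = ?G in osculating_planes_envelop W y A B C D P G \<and>
          tangential_cone y P G \<inter> tangent_plane y P = asymptotic_tangent_x y P \<union> asymptotic_tangent_u y P"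
        by (simp add: Let_def)
    qed
  next
    case (2 k k0 k1 k2 k3)
    then have k: "\<And>z. z \<in> W \<Longrightarrow> k z \<noteq> 0" and k_hol: "holomorphic2_on k W" "holomorphic2_on k0 W"
      "holomorphic2_on k1 W" "holomorphic2_on k2 W" "holomorphic2_on k3 W" by auto
    \<comment> \<open>Obtained by matching coefficients with \<open>nodal_cubic (k z / 2)\<close>:
      for instance k3 is - k / 2 times A - 2 b.\<close>
    define A where "A z = 2 * b z - 2 * k3 z / k z" for z
    define B where "B z = 2 * k2 z / k z - 2 * a z" for z
    define C where "C z = 2 * b1 z - 2 * k1 z / k z" for z
    define D where "D z = 2 * k0 z / k z - 2 * a1 z" for z
    have hol: "\<forall>f\<in>{A, B, C, D}. holomorphic2_on f W"
      unfolding A_def[abs_def] B_def[abs_def] C_def[abs_def] D_def[abs_def]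
      using W k k_hol coefficients_hol by (auto intro!: holomorphic2_intros)
    have contact: "contact_cubic (k z) (k0 z) (k1 z) (k2 z) (k3 z)
        = nodal_cubic (k z / 2) (A z - 2 * b z) (B z + 2 * a z) (C z - 2 * b1 z) (D z + 2 * a1 z)" if "z \<in> W" for z
      using k[OF that] by (simp add: A_def B_def C_def D_def)
    have zeros: "{U. contact_cubic (k z) (k0 z) (k1 z) (k2 z) (k3 z) U = 0} =
        {U. nodal_cubic 1 (A z - 2 * b z) (B z + 2 * a z) (C z - 2 * b1 z) (D z + 2 * a1 z) U = 0}" if "z \<in> W" for z
    proof -
      \<comment> \<open>A nonzero factor preserves the zero set, so the comparison with
        \<open>cone_cubic\<close> takes place at \<kappa> = 1, where the coefficients are
        unique.\<close>
      have scale: "nodal_cubic \<kappa> K0 K1 K2 K3 U = \<kappa> * nodal_cubic 1 K0 K1 K2 K3 U" for \<kappa> K0 K1 K2 K3 U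
        by (simp add: contact_cubic_def algebra_simps)
      have zero_iff: "nodal_cubic (k z / 2) K0 K1 K2 K3 U = 0 \<longleftrightarrow> nodal_cubic 1 K0 K1 K2 K3 U = 0" for K0 K1 K2 K3 U
        by (subst scale) (use k[OF that] in simp)
      show ?thesis
        unfolding contact[OF that] zero_iff ..
    qed
    show ?case
    proof (rule exI[of _ A], rule exI[of _ B], rule exI[of _ C], rule exI[of _ D], intro conjI hol ballI allI impI)
      fix z assume z: "z \<in> W"
      show "{U. contact_cubic (k z) (k0 z) (k1 z) (k2 z) (k3 z) U = 0} =
          {U. cone_cubic (a z) (b z) (a1 z) (b1 z) (D z) (C z / 3) (B z / 3) (A z) U = 0}"
        unfolding cone_cubic_nodal by (rule zeros[OF z])
    next
      fix z assume z: "z \<in> W" and nz: "k0 z \<noteq> 0 \<and> k3 z \<noteq> 0"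
      \<comment> \<open>Here A - 2 b = - 2 k3 / k and D + 2 a1 = 2 k0 / k, so \<open>nz\<close> is
        exactly the generic case.\<close>
      then show "osculating_planes_envelop W y A B C D z (contact_cubic (k z) (k0 z) (k1 z) (k2 z) (k3 z))"
        using hol k[OF z] by (intro envelop[OF hol z _ _ _ contact[OF z]]) (auto simp: A_def D_def)
    next
      fix A' B' C' D' z
      assume eq: "\<forall>z\<in>W. {U. contact_cubic (k z) (k0 z) (k1 z) (k2 z) (k3 z) U = 0} =
          {U. cone_cubic (a z) (b z) (a1 z) (b1 z) (D' z) (C' z / 3) (B' z / 3) (A' z) U = 0}" and z: "z \<in> W"
      have "{U. nodal_cubic 1 (A' z - 2 * b z) (B' z + 2 * a z) (C' z - 2 * b1 z) (D' z + 2 * a1 z) U = 0}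
        = {U. nodal_cubic 1 (A z - 2 * b z) (B z + 2 * a z) (C z - 2 * b1 z) (D z + 2 * a1 z) U = 0}"
        using trans[OF bspec[OF eq z, symmetric] zeros[OF z]] unfolding cone_cubic_nodal .
      from nodal_cubic_zero_set_inj[OF this]
      show "A' z = A z" "B' z = B z" "C' z = C z" "D' z = D z" by simp_all
    qed
  next
    case (3 A B C D \<xi> \<upsilon> T t0)
    then show ?case by (intro geodesic_parametric_iff) auto
  qed
qed

end
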